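(* The generator $G$ of the minimal semigroup $(Z(t))_{t\ge0}$ is $G=\overline{A+K}$ (the closure of $A+K$ in $\mathcal X$). In particular $(Z(t))_{t\ge0}$ is honest (conservative): $$\int_{\mathbb R^3\times\mathbb R^3}Z(t)f(x,v)\,dx\,dv=\int_{\mathbb R^3\times\mathbb R^3}f(x,v)\,dx\,dv\qquad\text{for all }f\in\mathcal X,\ t\ge0.$$
   Context: Fix masses $m,m_1>0$, a constant restitution coefficient $\epsilon\in(0,1)$, a bulk velocity $u_1\in\mathbb R^3$ and a temperature $\vartheta_1>0$. Let $\mathcal M_1(v)=\big(\frac{m_1}{2\pi\vartheta_1}\big)^{3/2}\exp\big(-\frac{m_1|v-u_1|^2}{2\vartheta_1}\big)$, $\alpha=\frac{m_1}{m+m_1}$, $\beta=\frac{1-\epsilon}{2}$, $\gamma=\alpha\frac{1-\beta}{1-2\beta}$, $\bar\gamma=(1-\alpha)\frac{1-\beta}{1-2\beta}$. For $v,w\in\mathbb R^3$, $n\in\mathbb S^2$, $q=v-w$, let $v_\star=v-2\gamma(q\cdot n)n$, $w_\star=w+2\bar\gamma(q\cdot n)n$, and $\sigma(v)=\int_{\mathbb R^3\times\mathbb S^2}|q\cdot n|\mathcal M_1(w)\,dw\,dn$. Let $\mathcal X=L^1(\mathbb R^3\times\mathbb R^3,dx\otimes dv)$; $T_0f=-v\cdot\nabla_xf$ with $\mathscr D(T_0)=\{f\in\mathcal X:v\cdot\nabla_xf\in\mathcal X\}$; $\Sigma f=-\sigma(v)f$ with $\mathscr D(\Sigma)=\{f\in\mathcal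 X:\sigma f\in\mathcal X\}$; $A=T_0+\Sigma$ on $\mathscr D(A)=\mathscr D(T_0)\cap\mathscr D(\Sigma)$ (it generates the contraction semigroup $V(t)f(x,v)=e^{-\sigma(v)t}f(x-tv,v)$); and $K$, with $\mathscr D(K)=\mathscr D(A)$, is $Kf(x,v)=\epsilon^{-2}\int_{\mathbb R^3\times\mathbb S^2}|q\cdot n|f(x,v_\star)\mathcal M_1(w_\star)\,dw\,dn$. Then $K\ge0$ and $\int(Af+Kf)\,dx\,dv=0$ for $f\in\mathscr D(A)$, $f\ge0$, and by substochastic perturbation theory there is a positive contraction $C_0$-semigroup $(Z(t))_{t\ge0}$ on $\mathcal X$ whose generator $G$ extends $A+K$ and which is minimal: any positive $C_0$-semigroup $(T(t))$ whose generator extends $A+K$ satisfies $T(t)\ge Z(t)$ for all $t\ge0$. *)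

theory Defs
  imports "HOL-Analysis.Analysis"
begin

type_synonym vec3 = "real^3"
type_synonym phase = "vec3 \<times> vec3"   (* (x, v) *)
type_synonym fn = "phase \<Rightarrow> real"

section \<open>The space X = L^1(R^3 x R^3, dx dv), handled through representatives\<close>

definition L1 :: "fn \<Rightarrow> bool" where
  "L1 f \<longleftrightarrow> integrable lborel f"

definition aeq :: "fn \<Rightarrow> fn \<Rightarrow> bool" where
  "aeq f g \<longleftrightarrow> (AE z in lborel. f z = g z)"

definition l1norm :: "fn \<Rightarrow> real" where
  "l1norm f = (\<integral>z. \<bar>f z\<bar> \<partial>lborel)"

section \<open>Surface measure on the unit sphere S^2 (cone-measure construction)\<close>

text \<open>For Borel g on the sphere, the integral of g over S^2 w.r.t. surface measure equals
  3 times the integral over the unit ball of g(y/|y|).\<close>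
definition sphere_meas :: "vec3 measure" where
  "sphere_meas = distr (density lborel (\<lambda>y. ennreal 3 * indicator (ball 0 1) y)) borel
                       (\<lambda>y. y /\<^sub>R norm y)"

fun Ck :: "nat \<Rightarrow> (phase \<Rightarrow> real) \<Rightarrow> bool" where
  "Ck 0 f \<longleftrightarrow> continuous_on UNIV f"
| "Ck (Suc k) f \<longleftrightarrow> continuous_on UNIV f \<and> (\<forall>z. f differentiable (at z)) \<and>
      (\<forall>i\<in>Basis. Ck k (\<lambda>z. frechet_derivative f (at z) i))"

definition test_fun :: "(phase \<Rightarrow> real) \<Rightarrow> bool" where
  "test_fun \<phi> \<longleftrightarrow> (\<forall>k. Ck k \<phi>) \<and> compact (closure {z. \<phi> z \<noteq> 0})"

definition Maxw :: "real \<Rightarrow> vec3 \<Rightarrow> real \<Rightarrow> vec3 \<Rightarrow> real" where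
  "Maxw m1 u1 th1 v = (m1 / (2 * pi * th1)) powr (3/2) * exp (- m1 * (norm (v - u1))\<^sup>2 / (2 * th1))"

definition alpha :: "real \<Rightarrow> real \<Rightarrow> real" where
  "alpha m m1 = m1 / (m + m1)"

definition beta :: "real \<Rightarrow> real" where
  "beta eps = (1 - eps) / 2"

definition gam :: "real \<Rightarrow> real \<Rightarrow> real \<Rightarrow> real" where
  "gam m m1 eps = alpha m m1 * (1 - beta eps) / (1 - 2 * beta eps)"

definition gambar :: "real \<Rightarrow> real \<Rightarrow> real \<Rightarrow> real" where
  "gambar m m1 eps = (1 - alpha m m1) * (1 - beta eps) / (1 - 2 * beta eps)"

definition vstar :: "real \<Rightarrow> real \<Rightarrow> real \<Rightarrow> vec3 \<Rightarrow> vec3 \<Rightarrow> vec3 \<Rightarrow> vec3" where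
  "vstar m m1 eps v w n = v - (2 * gam m m1 eps * ((v - w) \<bullet> n)) *\<^sub>R n"

definition wstar :: "real \<Rightarrow> real \<Rightarrow> real \<Rightarrow> vec3 \<Rightarrow> vec3 \<Rightarrow> vec3 \<Rightarrow> vec3" where
  "wstar m m1 eps v w n = w + (2 * gambar m m1 eps * ((v - w) \<bullet> n)) *\<^sub>R n"

definition coll_freq :: "real \<Rightarrow> vec3 \<Rightarrow> real \<Rightarrow> vec3 \<Rightarrow> real" where
  "coll_freq m1 u1 th1 v =
     (\<integral>p. \<bar>(v - fst p) \<bullet> snd p\<bar> * Maxw m1 u1 th1 (fst p) \<partial>(lborel \<Otimes>\<^sub>M sphere_meas))"

definition Kop :: "real \<Rightarrow> real \<Rightarrow> real \<Rightarrow> vec3 \<Rightarrow> real \<Rightarrow> fn \<Rightarrow> fn" where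
  "Kop m m1 eps u1 th1 f z =
     (let x = fst z; v = snd z in
      eps powr (-2) *
      (\<integral>p. \<bar>(v - fst p) \<bullet> snd p\<bar> * f (x, vstar m m1 eps v (fst p) (snd p)) *
            Maxw m1 u1 th1 (wstar m m1 eps v (fst p) (snd p)) \<partial>(lborel \<Otimes>\<^sub>M sphere_meas)))"

section \<open>Operators as relations (graphs) on representatives\<close>

text \<open>Free transport T0 f = - v . grad_x f, with v . grad_x f the distributional derivative.\<close>
definition T0rel :: "fn \<Rightarrow> fn \<Rightarrow> bool" where
  "T0rel f g \<longleftrightarrow> L1 f \<and> L1 g \<and>
     (\<forall>\<phi>. test_fun \<phi> \<longrightarrow>
        (\<integral>z. g z * \<phi> z \<partial>lborel) = (\<integral>z. f z * frechet_derivative \<phi> (at z) (snd z, 0) \<partial>lborel))"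

definition Arel :: "real \<Rightarrow> vec3 \<Rightarrow> real \<Rightarrow> fn \<Rightarrow> fn \<Rightarrow> bool" where
  "Arel m1 u1 th1 f g \<longleftrightarrow> L1 g \<and> (\<exists>h. T0rel f h \<and> L1 (\<lambda>z. coll_freq m1 u1 th1 (snd z) * f z) \<and>
       aeq g (\<lambda>z. h z - coll_freq m1 u1 th1 (snd z) * f z))"

definition AKrel :: "real \<Rightarrow> real \<Rightarrow> real \<Rightarrow> vec3 \<Rightarrow> real \<Rightarrow> fn \<Rightarrow> fn \<Rightarrow> bool" where
  "AKrel m m1 eps u1 th1 f g \<longleftrightarrow> L1 g \<and>
     (\<exists>h. Arel m1 u1 th1 f h \<and> aeq g (\<lambda>z. h z + Kop m m1 eps u1 th1 f z))"

definition op_closure :: "(fn \<Rightarrow> fn \<Rightarrow> bool) \<Rightarrow> fn \<Rightarrow> fn \<Rightarrow> bool" where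
  "op_closure R f g \<longleftrightarrow> L1 f \<and> L1 g \<and>
     (\<exists>fs gs. (\<forall>n. R (fs n) (gs n)) \<and>
        (\<lambda>n. l1norm (\<lambda>z. fs n z - f z)) \<longlonglongrightarrow> 0 \<and>
        (\<lambda>n. l1norm (\<lambda>z. gs n z - g z)) \<longlonglongrightarrow> 0)"

definition C0_semigroup :: "(real \<Rightarrow> fn \<Rightarrow> fn) \<Rightarrow> bool" where
  "C0_semigroup T \<longleftrightarrow>
     (\<forall>t\<ge>0. \<forall>f. L1 f \<longrightarrow> L1 (T t f)) \<and>
     (\<forall>t\<ge>0. \<forall>f g. L1 f \<longrightarrow> L1 g \<longrightarrow> aeq f g \<longrightarrow> aeq (T t f) (T t g)) \<and>
     (\<forall>t\<ge>0. \<forall>f g c. L1 f \<longrightarrow> L1 g \<longrightarrow>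
        aeq (T t (\<lambda>z. f z + c * g z)) (\<lambda>z. T t f z + c * T t g z)) \<and>
     (\<forall>t\<ge>0. \<exists>M. \<forall>f. L1 f \<longrightarrow> l1norm (T t f) \<le> M * l1norm f) \<and>
     (\<forall>f. L1 f \<longrightarrow> aeq (T 0 f) f) \<and>
     (\<forall>s\<ge>0. \<forall>t\<ge>0. \<forall>f. L1 f \<longrightarrow> aeq (T (s + t) f) (T s (T t f))) \<and>
     (\<forall>f. L1 f \<longrightarrow> ((\<lambda>t. l1norm (\<lambda>z. T t f z - f z)) \<longlongrightarrow> 0) (at_right 0))"

definition positive_sg :: "(real \<Rightarrow> fn \<Rightarrow> fn) \<Rightarrow> bool" where
  "positive_sg T \<longleftrightarrow> (\<forall>t\<ge>0. \<forall>f. L1 f \<longrightarrow> (AE z in lborel. 0 \<le> f z) \<longrightarrow>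
                        (AE z in lborel. 0 \<le> T t f z))"

definition contraction_sg :: "(real \<Rightarrow> fn \<Rightarrow> fn) \<Rightarrow> bool" where
  "contraction_sg T \<longleftrightarrow> (\<forall>t\<ge>0. \<forall>f. L1 f \<longrightarrow> l1norm (T t f) \<le> l1norm f)"

definition generator :: "(real \<Rightarrow> fn \<Rightarrow> fn) \<Rightarrow> fn \<Rightarrow> fn \<Rightarrow> bool" where
  "generator T f g \<longleftrightarrow> L1 f \<and> L1 g \<and>
     ((\<lambda>t. l1norm (\<lambda>z. (T t f z - f z) / t - g z)) \<longlongrightarrow> 0) (at_right 0)"

definition extends_op :: "(fn \<Rightarrow> fn \<Rightarrow> bool) \<Rightarrow> (fn \<Rightarrow> fn \<Rightarrow> bool) \<Rightarrow> bool" where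
  "extends_op G R \<longleftrightarrow> (\<forall>f g. R f g \<longrightarrow> G f g)"

end

theory Submission
  imports Defs
begin

text \<open>
  Fix \<open>\<lambda>\<close> large and let \<open>R = (\<lambda> - A)\<inverse>\<close>. It suffices to find, for every \<open>h\<close>, domain elements \<open>f\<close>
  of \<open>A + K\<close> with \<open>(\<lambda> - A - K) f\<close> arbitrarily close to \<open>h\<close>: the generator of a contraction semigroup
  is closed and dissipative, so it is then the closure of \<open>A + K\<close>, and \<open>\<integral> (A + K) f = 0\<close> passes to the
  generator and makes the total mass constant along orbits.

  For \<open>f = \<Sum>k<n. R (K R)\<^sup>k h\<close> one has \<open>(\<lambda> - A - K) f = h - (K R)\<^sup>n h\<close>. That \<open>(K R)\<^sup>n h \<rightarrow> 0\<close> in \<open>L\<^sup>1\<close>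
  is an energy estimate. With \<open>\<psi>(v) = 1 + |v|\<^sup>2\<close>, energy dissipation in the collisions gives
  \<open>K\<^sup>* \<psi> \<le> \<sigma> \<psi> + (\<lambda> - 1) \<psi>\<close>, hence \<open>\<parallel>\<psi> K R g\<parallel> + \<parallel>\<psi> R g\<parallel> \<le> \<parallel>\<psi> g\<parallel>\<close> for \<open>g \<ge> 0\<close>. So the norms
  \<open>\<parallel>\<psi> R (K R)\<^sup>k h\<parallel>\<close> are summable, and they dominate \<open>\<parallel>(K R)\<^sup>k\<^sup>+\<^sup>1 h\<parallel> = \<parallel>\<sigma> R (K R)\<^sup>k h\<parallel>\<close> because
  \<open>\<sigma>\<close> grows only linearly.
\<close>

section \<open>Generators of contraction semigroups on \<open>L\<^sup>1\<close>\<close>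

text \<open>Since \<open>sig\<close> is unbounded, \<open>K R\<close> is a contraction on
  \<open>L^1\<close> but not a strict one, so no norm bound sums the Neumann series. Decay of its
  terms is obtained only for nonnegative \<open>h\<close> of finite energy; a general
  \<open>h\<close> is reached by cutting off large velocities and splitting into positive and
  negative parts. The size of \<open>lam\<close> is dictated by weak collisions: energy may grow
  when the normal relative velocity is small compared with the normal velocity of the field
  particle. Weighted by the collision kernel this gain is at most cubic in \<open>w\<close>, which
  is why a third moment of the Maxwellian appears; one further unit in \<open>lam\<close> yields the
  summable term. Elements of \<open>L^1\<close> are representatives, and no integral of an orbit
  with values in \<open>L^1\<close> is formed: \<open>Z t f - f\<close> is instead cut into
  \<open>N\<close> short increments. The adjoint identities are Tonelli computations in
  \<open>ennreal\<close> for nonnegative functions. The real operators, whose integrals default to 0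
  on divergence, are compared with them almost everywhere.\<close>

lemma L1_add: "L1 f \<Longrightarrow> L1 g \<Longrightarrow> L1 (\<lambda>z. f z + g z)"
  and L1_diff: "L1 f \<Longrightarrow> L1 g \<Longrightarrow> L1 (\<lambda>z. f z - g z)"
  and L1_scale: "L1 f \<Longrightarrow> L1 (\<lambda>z. c * f z)"
  and L1_divide: "L1 f \<Longrightarrow> L1 (\<lambda>z. f z / c)"
  by (auto simp: L1_def)

lemmas L1_intros = L1_add L1_diff L1_scale L1_divide

lemma L1_mult_bounded:
  assumes g: "L1 g" and h[measurable]: "h \<in> borel_measurable borel" and C: "\<exists>C. \<forall>z. \<bar>h z\<bar> \<le> C"
  shows "L1 (\<lambda>z. g z * h z)"
proof -
  obtain C where C: "\<And>z. \<bar>h z\<bar> \<le> C" using C by blast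
  have [measurable]: "g \<in> borel_measurable borel" using g by (simp add: L1_def)
  show ?thesis unfolding L1_def
  proof (rule Bochner_Integration.integrable_bound)
    show "integrable lborel (\<lambda>z. C * g z)" using g by (simp add: L1_def)
    show "AE z in lborel. norm (g z * h z) \<le> norm (C * g z)"
    proof (intro AE_I2)
      fix z
      have "\<bar>h z\<bar> \<le> \<bar>C\<bar>" using C[of z] by linarith
      then show "norm (g z * h z) \<le> norm (C * g z)"
        by (simp add: abs_mult mult.commute[of "\<bar>C\<bar>"] mult_left_mono)
    qed
  qed measurable
qed

lemma l1norm_nonneg: "0 \<le> l1norm f"
  unfolding l1norm_def by simp

lemma l1norm_cong:
  assumes "L1 f" "L1 g" "aeq f g"
  shows "l1norm f = l1norm g"
  unfolding l1norm_def using assms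
  by (intro integral_cong_AE) (auto simp: L1_def aeq_def)

lemma l1norm_triangle:
  assumes "L1 f" "L1 g"
  shows "l1norm (\<lambda>z. f z + g z) \<le> l1norm f + l1norm g"
proof -
  have "l1norm (\<lambda>z. f z + g z) \<le> (\<integral>z. \<bar>f z\<bar> + \<bar>g z\<bar> \<partial>lborel)"
    unfolding l1norm_def using assms
    by (intro integral_mono) (auto simp: L1_def abs_triangle_ineq)
  also have "\<dots> = l1norm f + l1norm g"
    unfolding l1norm_def using assms by (intro Bochner_Integration.integral_add) (auto simp: L1_def)
  finally show ?thesis .
qed

lemma l1norm_scale: "l1norm (\<lambda>z. c * f z) = \<bar>c\<bar> * l1norm f"
  unfolding l1norm_def by (simp add: abs_mult)

lemma l1norm_diff_commute: "l1norm (\<lambda>z. f z - g z) = l1norm (\<lambda>z. g z - f z)"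
  unfolding l1norm_def by (simp add: abs_minus_commute)

lemma abs_integral_le_l1norm: "\<bar>\<integral>z. f z \<partial>lborel\<bar> \<le> l1norm f"
  unfolding l1norm_def by (rule integral_abs_bound)

lemma integral_L1_diff:
  "L1 f \<Longrightarrow> L1 g \<Longrightarrow> (\<integral>z. f z - g z \<partial>lborel) = (\<integral>z. f z \<partial>lborel) - (\<integral>z. g z \<partial>lborel)"
  by (simp add: L1_def)

lemma integral_aeq: "L1 f \<Longrightarrow> L1 g \<Longrightarrow> aeq f g \<Longrightarrow> (\<integral>z. f z \<partial>lborel) = (\<integral>z. g z \<partial>lborel)"
  by (intro integral_cong_AE) (auto simp: L1_def aeq_def)

lemma l1norm_tendsto_zero_squeeze:
  assumes "\<forall>\<^sub>F x in F. l1norm (f x) \<le> u x" and "(u \<longlongrightarrow> 0) F"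
  shows "((\<lambda>x. l1norm (f x)) \<longlongrightarrow> 0) F"
  by (rule tendsto_sandwich[OF _ assms(1) tendsto_const assms(2)]) (simp add: l1norm_nonneg)

section \<open>Contraction semigroups and their generators\<close>

locale contraction_semigroup =
  fixes Z :: "real \<Rightarrow> fn \<Rightarrow> fn"
  assumes sg: "C0_semigroup Z" and contr: "contraction_sg Z"
begin

lemma L1_Z: "0 \<le> t \<Longrightarrow> L1 f \<Longrightarrow> L1 (Z t f)"
  by (rule sg[unfolded C0_semigroup_def, THEN conjunct1, rule_format])

lemma Z_linear: "0 \<le> t \<Longrightarrow> L1 f \<Longrightarrow> L1 g \<Longrightarrow>
    aeq (Z t (\<lambda>z. f z + c * g z)) (\<lambda>z. Z t f z + c * Z t g z)"
  by (rule sg[unfolded C0_semigroup_def, THEN conjunct2, THEN conjunct2, THEN conjunct1, rule_format])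

lemma Z_0: "L1 f \<Longrightarrow> aeq (Z 0 f) f"
  by (rule sg[unfolded C0_semigroup_def, THEN conjunct2, THEN conjunct2, THEN conjunct2, THEN conjunct2, THEN conjunct1, rule_format])

lemma Z_add: "0 \<le> s \<Longrightarrow> 0 \<le> t \<Longrightarrow> L1 f \<Longrightarrow> aeq (Z (s + t) f) (Z s (Z t f))"
  by (rule sg[unfolded C0_semigroup_def, THEN conjunct2, THEN conjunct2, THEN conjunct2, THEN conjunct2, THEN conjunct2, THEN conjunct1, rule_format])

lemma Z_cont: "L1 f \<Longrightarrow> ((\<lambda>t. l1norm (\<lambda>z. Z t f z - f z)) \<longlongrightarrow> 0) (at_right 0)"
  by (rule sg[unfolded C0_semigroup_def, THEN conjunct2, THEN conjunct2, THEN conjunct2, THEN conjunct2, THEN conjunct2, THEN conjunct2, rule_format])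

lemma Z_contr: "0 \<le> t \<Longrightarrow> L1 f \<Longrightarrow> l1norm (Z t f) \<le> l1norm f"
  using contr unfolding contraction_sg_def by blast

lemma Z_diff:
  assumes "0 \<le> t" "L1 f" "L1 g"
  shows "aeq (Z t (\<lambda>z. f z - g z)) (\<lambda>z. Z t f z - Z t g z)"
  using Z_linear[OF assms, of "-1"] by simp

lemma Z_scale:
  assumes "0 \<le> t" "L1 f"
  shows "aeq (Z t (\<lambda>z. c * f z)) (\<lambda>z. c * Z t f z)"
  using Z_linear[OF assms(1) assms(2) assms(2), of "c - 1"]
  by (simp add: algebra_simps)

lemma Z_contr_diff:
  assumes "0 \<le> t" "L1 f" "L1 g"
  shows "l1norm (\<lambda>z. Z t f z - Z t g z) \<le> l1norm (\<lambda>z. f z - g z)"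
proof -
  have "l1norm (\<lambda>z. Z t f z - Z t g z) = l1norm (Z t (\<lambda>z. f z - g z))"
    using assms Z_diff[OF assms]
    by (intro l1norm_cong L1_diff L1_Z) (auto simp: aeq_def elim: eventually_mono)
  also have "\<dots> \<le> l1norm (\<lambda>z. f z - g z)"
    using assms by (intro Z_contr L1_diff)
  finally show ?thesis .
qed

lemma generator_L1: "generator Z f g \<Longrightarrow> L1 f \<and> L1 g"
  unfolding generator_def by blast

text \<open>Multiplied form of the difference quotient: the errors \<open>s * d\<close> of
  \<open>N\<close> steps of length \<open>s\<close> add up to \<open>N * s * d\<close>, which
  depends only on the total time \<open>N * s\<close>.\<close>

lemma generator_small:
  assumes "generator Z f g" "0 < d"
  obtains r where "0 < r"
    "\<And>s. 0 < s \<Longrightarrow> s < r \<Longrightarrow> l1norm (\<lambda>z. Z s f z - f z - s * g z) \<le> s * d"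
proof -
  have "((\<lambda>t. l1norm (\<lambda>z. (Z t f z - f z) / t - g z)) \<longlongrightarrow> 0) (at_right 0)"
    using assms unfolding generator_def by blast
  then have "\<forall>\<^sub>F t in at_right 0. l1norm (\<lambda>z. (Z t f z - f z) / t - g z) < d"
    using assms(2) by (rule order_tendstoD)
  then obtain r where r: "0 < r"
    "\<And>t. 0 < t \<Longrightarrow> t < r \<Longrightarrow> l1norm (\<lambda>z. (Z t f z - f z) / t - g z) < d"
    unfolding eventually_at_right_field by auto
  have "l1norm (\<lambda>z. Z s f z - f z - s * g z) \<le> s * d" if s: "0 < s" "s < r" for s
  proof -
    have "(\<lambda>z. Z s f z - f z - s * g z) = (\<lambda>z. s * ((Z s f z - f z) / s - g z))"
      using s by (auto simp: field_simps)
    then have "l1norm (\<lambda>z. Z s f z - f z - s * g z) = s * l1norm (\<lambda>z. (Z s f z - f z) / s - g z)"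
      using s by (simp only: l1norm_scale)
    then show ?thesis using r(2)[OF s] s by simp
  qed
  with r(1) that show thesis by blast
qed

text \<open>The time \<open>s = 0\<close> is included because the telescoping sums start with the
  unmoved term \<open>k = 0\<close>.\<close>

lemma Z_cont_small:
  assumes "L1 f" "0 < d"
  obtains r where "0 < r" "\<And>s. 0 \<le> s \<Longrightarrow> s < r \<Longrightarrow> l1norm (\<lambda>z. Z s f z - f z) \<le> d"
proof -
  have "\<forall>\<^sub>F t in at_right 0. l1norm (\<lambda>z. Z t f z - f z) < d"
    using Z_cont[OF assms(1)] assms(2) by (rule order_tendstoD)
  then obtain r where r: "0 < r"
    "\<And>t. 0 < t \<Longrightarrow> t < r \<Longrightarrow> l1norm (\<lambda>z. Z t f z - f z) < d"
    unfolding eventually_at_right_field by auto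
  have "l1norm (\<lambda>z. Z 0 f z - f z) = l1norm (\<lambda>z. 0 :: real)"
    using Z_0[OF assms(1)] assms(1)
    by (intro l1norm_cong L1_diff L1_Z) (auto simp: aeq_def L1_def elim: eventually_mono)
  then have "l1norm (\<lambda>z. Z 0 f z - f z) \<le> d" using assms(2) by (simp add: l1norm_def)
  with r that[of r] show thesis by (metis less_eq_real_def)
qed

text \<open>The increment over \<open>N\<close> steps telescopes; each step is the image under a contraction
  of the first one.\<close>

lemma increment_step:
  assumes "0 \<le> t" "0 \<le> s" "L1 f" "L1 g"
  shows "aeq (\<lambda>z. Z (t + s) f z - Z t f z) (\<lambda>z. Z t (\<lambda>z. Z s f z - f z - s * g z) z + s * Z t g z)"
proof -
  have L: "L1 (\<lambda>z. Z s f z - f z)" "L1 (Z s f)" using assms by (auto intro!: L1_intros L1_Z)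
  have "aeq (Z t (\<lambda>z. (Z s f z - f z) + (- s) * g z)) (\<lambda>z. Z t (\<lambda>z. Z s f z - f z) z + (- s) * Z t g z)"
    using assms L by (intro Z_linear) auto
  moreover have "aeq (Z t (\<lambda>z. Z s f z - f z)) (\<lambda>z. Z t (Z s f) z - Z t f z)"
    using assms L by (intro Z_diff) auto
  moreover have "aeq (Z (t + s) f) (Z t (Z s f))" using assms by (intro Z_add)
  ultimately show ?thesis unfolding aeq_def
    by eventually_elim simp
qed

text \<open>A discrete stand-in for writing \<open>Z t f - f\<close> as the time integral of
  \<open>Z s g\<close>. Contractivity turns the exchange of \<open>g\<close> for \<open>g0\<close>
  into the norm of \<open>g - g0\<close>, so continuity in time is asked of \<open>g0\<close> alone.
  Hence the bound is uniform along pairs \<open>(f, g)\<close> whose second component tends to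
  \<open>g0\<close>.\<close>

lemma increment_bound:
  assumes "0 \<le> s" "L1 f" "L1 g" "L1 g0"
    and e: "l1norm (\<lambda>z. Z s f z - f z - s * g z) \<le> e"
    and w: "\<And>k. k < N \<Longrightarrow> l1norm (\<lambda>z. Z (real k * s) g0 z - g0 z) \<le> w"
  shows "l1norm (\<lambda>z. Z (real N * s) f z - f z - real N * s * g0 z)
           \<le> real N * (e + s * l1norm (\<lambda>z. g z - g0 z) + s * w)"
  using w
proof (induction N)
  case 0
  have "l1norm (\<lambda>z. Z (real 0 * s) f z - f z - real 0 * s * g0 z) = l1norm (\<lambda>z. 0 :: real)"
    using Z_0[OF assms(2)] assms(2)
    by (intro l1norm_cong) (auto intro!: L1_intros L1_Z simp: aeq_def L1_def[of "\<lambda>_. 0"] elim: eventually_mono)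
  then show ?case by (simp add: l1norm_def)
next
  case (Suc N)
  let ?t = "real N * s"
  have t: "0 \<le> ?t" using assms by simp
  let ?a = "\<lambda>z. Z ?t f z - f z - ?t * g0 z"
  let ?b = "\<lambda>z. Z ?t (\<lambda>z. Z s f z - f z - s * g z) z"
  let ?c = "\<lambda>z. s * (Z ?t g z - Z ?t g0 z)"
  let ?d = "\<lambda>z. s * (Z ?t g0 z - g0 z)"
  have L: "L1 ?a" "L1 ?b" "L1 ?c" "L1 ?d"
    using assms t by (auto intro!: L1_intros L1_Z)
  have "aeq (\<lambda>z. Z (?t + s) f z - Z ?t f z) (\<lambda>z. ?b z + s * Z ?t g z)"
    using assms t by (intro increment_step)
  then have "aeq (\<lambda>z. Z (?t + s) f z - f z - (?t + s) * g0 z) (\<lambda>z. (?a z + ?b z) + (?c z + ?d z))"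
    unfolding aeq_def by eventually_elim (simp add: algebra_simps)
  then have "l1norm (\<lambda>z. Z (?t + s) f z - f z - (?t + s) * g0 z) = l1norm (\<lambda>z. (?a z + ?b z) + (?c z + ?d z))"
    using assms t L by (intro l1norm_cong) (auto intro!: L1_add[OF L1_add L1_add] L1_diff L1_Z L1_scale)
  also have "\<dots> \<le> l1norm (\<lambda>z. ?a z + ?b z) + l1norm (\<lambda>z. ?c z + ?d z)"
    using L by (intro l1norm_triangle L1_add)
  also have "\<dots> \<le> (l1norm ?a + l1norm ?b) + (l1norm ?c + l1norm ?d)"
    using L by (intro add_mono l1norm_triangle)
  also have "l1norm ?a \<le> real N * (e + s * l1norm (\<lambda>z. g z - g0 z) + s * w)"
    using Suc by simp
  also have "l1norm ?b \<le> e"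
  proof -
    have "L1 (\<lambda>z. Z s f z - f z - s * g z)" using assms by (intro L1_intros L1_Z)
    from Z_contr[OF t this] e show ?thesis by linarith
  qed
  also have "l1norm ?c \<le> s * l1norm (\<lambda>z. g z - g0 z)"
    using Z_contr_diff[OF t assms(3,4)] assms(1) by (simp add: l1norm_scale mult_left_mono)
  also have "l1norm ?d \<le> s * w"
    using Suc.prems[of N] assms(1) by (simp add: l1norm_scale mult_left_mono)
  finally show ?case by (simp add: algebra_simps)
qed

text \<open>On \<open>[0, t)\<close> the orbit of the limit \<open>g\<close> stays within some
  \<open>d\<close> of \<open>g\<close>. Refining the steps gives
  \<open>t * (l1norm (gs n - g) + d)\<close> for the pair with index \<open>n\<close>, a bound free
  of the speed at which its difference quotients converge; then \<open>n\<close> tends to infinity,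
  and \<open>d\<close> is small for small \<open>t\<close>.\<close>

lemma generator_closed:
  assumes gen: "\<And>n. generator Z (fs n) (gs n)" and L: "L1 f" "L1 g"
    and f: "(\<lambda>n. l1norm (\<lambda>z. fs n z - f z)) \<longlonglongrightarrow> 0"
    and g: "(\<lambda>n. l1norm (\<lambda>z. gs n z - g z)) \<longlonglongrightarrow> 0"
  shows "generator Z f g"
proof -
  have Ln: "L1 (fs n)" "L1 (gs n)" for n using generator_L1[OF gen] by auto
  have *: "l1norm (\<lambda>z. (Z t f z - f z) / t - g z) \<le> d"
    if t: "0 < t" and d: "0 < d" and w: "\<And>s. 0 \<le> s \<Longrightarrow> s < t \<Longrightarrow> l1norm (\<lambda>z. Z s g z - g z) \<le> d" for t d
  proof -
    have bn: "l1norm (\<lambda>z. Z t (fs n) z - fs n z - t * g z) \<le> t * (l1norm (\<lambda>z. gs n z - g z) + d)" for n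
    proof (rule field_le_epsilon)
      fix e :: real assume e: "0 < e"
      obtain r where r: "0 < r" "\<And>s. 0 < s \<Longrightarrow> s < r \<Longrightarrow>
          l1norm (\<lambda>z. Z s (fs n) z - fs n z - s * gs n z) \<le> s * (e / t)"
        using generator_small[OF gen, of "e / t" n] e t by auto
      \<comment> \<open>The radius \<open>r\<close> depends on \<open>n\<close> and
        \<open>e\<close>; steps of length \<open>t / N < r\<close> keep this dependence out of the
        final bound.\<close>
      obtain N where N: "t / r < real N" using reals_Archimedean2 by blast
      have N0: "0 < real N" using N r t by (smt (verit) divide_pos_pos)
      define s where "s = t / real N"
      have s: "0 < s" "s < r" "real N * s = t" using N N0 r t
        by (auto simp: s_def field_simps)
      have "l1norm (\<lambda>z. Z (real N * s) (fs n) z - fs n z - real N * s * g z)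
         \<le> real N * (s * (e / t) + s * l1norm (\<lambda>z. gs n z - g z) + s * d)"
      proof (rule increment_bound)
        fix k assume "k < N"
        then have "real k * s < real N * s" using s(1) by simp
        then show "l1norm (\<lambda>z. Z (real k * s) g z - g z) \<le> d" using s by (intro w) auto
      qed (use s Ln L r(2)[OF s(1,2)] in auto)
      also have "\<dots> = (real N * s) * (e / t + l1norm (\<lambda>z. gs n z - g z) + d)"
        by (simp add: algebra_simps)
      also have "\<dots> = t * (l1norm (\<lambda>z. gs n z - g z) + d) + e"
        unfolding s(3) using t by (simp add: field_simps)
      finally show "l1norm (\<lambda>z. Z t (fs n) z - fs n z - t * g z) \<le> t * (l1norm (\<lambda>z. gs n z - g z) + d) + e"
        unfolding s(3) .
    qed
    have "l1norm (\<lambda>z. Z t f z - f z - t * g z)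
        \<le> t * (l1norm (\<lambda>z. gs n z - g z) + d) + 2 * l1norm (\<lambda>z. fs n z - f z)" for n
    proof -
      have "l1norm (\<lambda>z. Z t f z - f z - t * g z)
         = l1norm (\<lambda>z. ((Z t f z - Z t (fs n) z) + (fs n z - f z)) + (Z t (fs n) z - fs n z - t * g z))"
        by (simp add: algebra_simps)
      also have "\<dots> \<le> l1norm (\<lambda>z. (Z t f z - Z t (fs n) z) + (fs n z - f z))
          + l1norm (\<lambda>z. Z t (fs n) z - fs n z - t * g z)"
        using t L Ln by (intro l1norm_triangle) (auto intro!: L1_intros L1_Z)
      also have "\<dots> \<le> (l1norm (\<lambda>z. Z t f z - Z t (fs n) z) + l1norm (\<lambda>z. fs n z - f z))
          + t * (l1norm (\<lambda>z. gs n z - g z) + d)"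
        using t L Ln by (intro add_mono bn l1norm_triangle) (auto intro!: L1_intros L1_Z)
      also have "l1norm (\<lambda>z. Z t f z - Z t (fs n) z) \<le> l1norm (\<lambda>z. f z - fs n z)"
        using t L Ln by (intro Z_contr_diff) auto
      finally show ?thesis by (simp add: l1norm_diff_commute[of f])
    qed
    moreover have "(\<lambda>n. t * (l1norm (\<lambda>z. gs n z - g z) + d) + 2 * l1norm (\<lambda>z. fs n z - f z))
       \<longlonglongrightarrow> t * (0 + d) + 2 * 0"
      by (intro tendsto_intros f g)
    ultimately have "l1norm (\<lambda>z. Z t f z - f z - t * g z) \<le> t * (0 + d) + 2 * 0"
      by (intro LIMSEQ_le_const) auto
    moreover have "(\<lambda>z. (Z t f z - f z) / t - g z) = (\<lambda>z. (1 / t) * (Z t f z - f z - t * g z))"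
      using t by (auto simp: field_simps)
    ultimately show ?thesis
      using t by (simp only: l1norm_scale) (simp add: field_simps)
  qed
  have "((\<lambda>t. l1norm (\<lambda>z. (Z t f z - f z) / t - g z)) \<longlongrightarrow> 0) (at_right 0)"
  proof (rule tendstoI)
    fix e :: real assume e: "0 < e"
    obtain r where r: "0 < r" "\<And>s. 0 \<le> s \<Longrightarrow> s < r \<Longrightarrow> l1norm (\<lambda>z. Z s g z - g z) \<le> e / 2"
      using Z_cont_small[OF L(2), of "e / 2"] e by auto
    have "l1norm (\<lambda>z. (Z t f z - f z) / t - g z) \<le> e / 2" if "0 < t" "t < r" for t
      using that r e by (intro *) auto
    then have "\<forall>t>0. t < r \<longrightarrow> dist (l1norm (\<lambda>z. (Z t f z - f z) / t - g z)) 0 < e"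
      using e by (force simp: l1norm_nonneg)
    with r(1) show "\<forall>\<^sub>F t in at_right 0. dist (l1norm (\<lambda>z. (Z t f z - f z) / t - g z)) 0 < e"
      unfolding eventually_at_right_field by auto
  qed
  then show ?thesis using L by (simp add: generator_def)
qed

lemma generator_diff:
  assumes "generator Z f g" "generator Z f' g'"
  shows "generator Z (\<lambda>z. f z - f' z) (\<lambda>z. g z - g' z)"
proof -
  have L: "L1 f" "L1 g" "L1 f'" "L1 g'" using assms generator_L1 by auto
  let ?D = "\<lambda>f g t z. (Z t f z - f z) / t - g z"
  have lim: "((\<lambda>t. l1norm (?D f g t) + l1norm (?D f' g' t)) \<longlongrightarrow> 0 + 0) (at_right 0)"
    using assms unfolding generator_def by (intro tendsto_add) auto
  have "l1norm (?D (\<lambda>z. f z - f' z) (\<lambda>z. g z - g' z) t) \<le> l1norm (?D f g t) + l1norm (?D f' g' t)"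
    if t: "0 < t" for t
  proof -
    have "aeq (Z t (\<lambda>z. f z - f' z)) (\<lambda>z. Z t f z - Z t f' z)"
      using t L by (intro Z_diff) auto
    then have "aeq (?D (\<lambda>z. f z - f' z) (\<lambda>z. g z - g' z) t) (\<lambda>z. ?D f g t z + (-1) * ?D f' g' t z)"
      unfolding aeq_def by eventually_elim (simp add: diff_divide_distrib)
    then have "l1norm (?D (\<lambda>z. f z - f' z) (\<lambda>z. g z - g' z) t) = l1norm (\<lambda>z. ?D f g t z + (-1) * ?D f' g' t z)"
      using t L by (intro l1norm_cong) (intro L1_intros L1_Z; simp)+
    also have "\<dots> \<le> l1norm (?D f g t) + l1norm (\<lambda>z. (-1) * ?D f' g' t z)"
      using t L by (intro l1norm_triangle) (intro L1_intros L1_Z; simp)+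
    finally show ?thesis using l1norm_scale[of "-1" "?D f' g' t"] by simp
  qed
  then have "\<forall>\<^sub>F t in at_right 0. l1norm (?D (\<lambda>z. f z - f' z) (\<lambda>z. g z - g' z) t)
      \<le> l1norm (?D f g t) + l1norm (?D f' g' t)"
    using eventually_at_right_less[of "0 :: real"] by (rule eventually_mono[rotated])
  then have "((\<lambda>t. l1norm (?D (\<lambda>z. f z - f' z) (\<lambda>z. g z - g' z) t)) \<longlongrightarrow> 0) (at_right 0)"
    using lim by (intro l1norm_tendsto_zero_squeeze) simp_all
  then show ?thesis using L by (simp add: generator_def L1_diff)
qed

text \<open>Write \<open>(1 + s * lam) f\<close> as \<open>s (lam f - g) + Z s f\<close> minus a
  remainder of size \<open>s * e\<close>. Contractivity lets \<open>l1norm (Z s f)\<close> cancel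
  one copy of \<open>l1norm f\<close>; what is left is divided by \<open>s\<close>.\<close>

lemma generator_dissipative:
  assumes gen: "generator Z f g" and lam: "0 < lam"
  shows "lam * l1norm f \<le> l1norm (\<lambda>z. lam * f z - g z)"
proof (rule field_le_epsilon)
  fix e :: real assume e: "0 < e"
  have L: "L1 f" "L1 g" using gen generator_L1 by auto
  obtain r where r: "0 < r" "\<And>s. 0 < s \<Longrightarrow> s < r \<Longrightarrow> l1norm (\<lambda>z. Z s f z - f z - s * g z) \<le> s * e"
    using generator_small[OF gen e] by blast
  define s where "s = r / 2"
  have s: "0 < s" "s < r" using r by (auto simp: s_def)
  have "(1 + s * lam) * l1norm f = l1norm (\<lambda>z. (s * (lam * f z - g z) + Z s f z) + (-1) * (Z s f z - f z - s * g z))"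
    using s lam l1norm_scale[of "1 + s * lam" f] by (simp add: algebra_simps)
  also have "\<dots> \<le> l1norm (\<lambda>z. s * (lam * f z - g z) + Z s f z) + l1norm (\<lambda>z. (-1) * (Z s f z - f z - s * g z))"
    using s L by (intro l1norm_triangle) (intro L1_intros L1_Z; simp)+
  also have "\<dots> \<le> (l1norm (\<lambda>z. s * (lam * f z - g z)) + l1norm (Z s f)) + s * e"
  proof (intro add_mono l1norm_triangle)
    show "L1 (\<lambda>z. s * (lam * f z - g z))" "L1 (Z s f)" using s L by (auto intro!: L1_intros L1_Z)
    show "l1norm (\<lambda>z. (-1) * (Z s f z - f z - s * g z)) \<le> s * e"
      using r(2)[OF s] l1norm_scale[of "-1" "\<lambda>z. Z s f z - f z - s * g z"] by simp
  qed
  also have "\<dots> \<le> s * l1norm (\<lambda>z. lam * f z - g z) + l1norm f + s * e"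
    using s L Z_contr[of s f] by (simp only: l1norm_scale) simp
  finally have "s * (lam * l1norm f) \<le> s * (l1norm (\<lambda>z. lam * f z - g z) + e)"
    by (simp add: algebra_simps)
  then show "lam * l1norm f \<le> l1norm (\<lambda>z. lam * f z - g z) + e"
    using s by simp
qed

text \<open>\<open>Z t\<close> commutes with difference quotients and is a contraction, so the
  quotients along the orbit converge at least as fast as those at the starting point.\<close>

lemma generator_Z:
  assumes gen: "generator Z f g" and t: "0 \<le> t"
  shows "generator Z (Z t f) (Z t g)"
proof -
  have L: "L1 f" "L1 g" using gen generator_L1 by auto
  let ?D = "\<lambda>f g t z. (Z t f z - f z) / t - g z"
  have "l1norm (?D (Z t f) (Z t g) s) \<le> l1norm (?D f g s)" if s: "0 < s" for s
  proof -
    have Ls: "L1 (Z s f)" "L1 (\<lambda>z. Z s f z - f z)" "L1 (\<lambda>z. (1 / s) * (Z s f z - f z))"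
      using s L by (auto intro!: L1_intros L1_Z)
    have "aeq (Z t (\<lambda>z. (1 / s) * (Z s f z - f z) - g z)) (\<lambda>z. Z t (\<lambda>z. (1 / s) * (Z s f z - f z)) z - Z t g z)"
      using t L Ls by (intro Z_diff)
    moreover have "aeq (Z t (\<lambda>z. (1 / s) * (Z s f z - f z))) (\<lambda>z. (1 / s) * Z t (\<lambda>z. Z s f z - f z) z)"
      using t Ls by (intro Z_scale)
    moreover have "aeq (Z t (\<lambda>z. Z s f z - f z)) (\<lambda>z. Z t (Z s f) z - Z t f z)"
      using t L Ls by (intro Z_diff)
    moreover have "aeq (Z (t + s) f) (Z t (Z s f))" using s t L by (intro Z_add) auto
    moreover have "aeq (Z (s + t) f) (Z s (Z t f))" using s t L by (intro Z_add) auto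
    ultimately have "aeq (?D (Z t f) (Z t g) s) (Z t (\<lambda>z. (1 / s) * (Z s f z - f z) - g z))"
      unfolding aeq_def by eventually_elim (simp add: add.commute)
    then have "l1norm (?D (Z t f) (Z t g) s) = l1norm (Z t (\<lambda>z. (1 / s) * (Z s f z - f z) - g z))"
      using s t L Ls by (intro l1norm_cong) (intro L1_intros L1_Z; simp)+
    also have "\<dots> \<le> l1norm (\<lambda>z. (1 / s) * (Z s f z - f z) - g z)"
      using t L Ls by (intro Z_contr L1_diff)
    finally show ?thesis by simp
  qed
  then have "\<forall>\<^sub>F s in at_right 0. l1norm (?D (Z t f) (Z t g) s) \<le> l1norm (?D f g s)"
    using eventually_at_right_less[of "0 :: real"] by (rule eventually_mono[rotated])
  moreover have "((\<lambda>s. l1norm (?D f g s)) \<longlongrightarrow> 0) (at_right 0)"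
    using gen unfolding generator_def by blast
  ultimately have "((\<lambda>s. l1norm (?D (Z t f) (Z t g) s)) \<longlongrightarrow> 0) (at_right 0)"
    by (rule l1norm_tendsto_zero_squeeze)
  then show ?thesis using L t by (simp add: generator_def L1_Z)
qed

text \<open>In each increment the first-order term \<open>s * Z ?t g\<close> has integral 0, because
  \<open>Z ?t g\<close> is again a value of the generator. Only the remainders change the mass, and
  over \<open>N\<close> steps they total at most \<open>e\<close>.\<close>

lemma integral_conserved_on_domain:
  assumes gen: "generator Z f g" and t: "0 \<le> t"
    and null: "\<And>f g. generator Z f g \<Longrightarrow> (\<integral>z. g z \<partial>lborel) = 0"
  shows "(\<integral>z. Z t f z \<partial>lborel) = (\<integral>z. f z \<partial>lborel)"
proof (cases "t = 0")
  case True
  then show ?thesis using Z_0[of f] generator_L1[OF gen] by (intro integral_aeq) (auto intro: L1_Z)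
next
  case False
  then have t: "0 < t" using t by simp
  have L: "L1 f" "L1 g" using gen generator_L1 by auto
  have "\<bar>(\<integral>z. Z t f z \<partial>lborel) - (\<integral>z. f z \<partial>lborel)\<bar> \<le> 0"
  proof (rule field_le_epsilon)
    fix e :: real assume e: "0 < e"
    obtain r where r: "0 < r" "\<And>s. 0 < s \<Longrightarrow> s < r \<Longrightarrow> l1norm (\<lambda>z. Z s f z - f z - s * g z) \<le> s * (e / t)"
      using generator_small[OF gen, of "e / t"] e t by auto
    obtain N where N: "t / r < real N" using reals_Archimedean2 by blast
    have N0: "0 < real N" using N r t by (smt (verit) divide_pos_pos)
    define s where "s = t / real N"
    have s: "0 < s" "s < r" "real N * s = t" using N N0 r t
      by (auto simp: s_def field_simps)
    have "\<bar>(\<integral>z. Z (real k * s) f z \<partial>lborel) - (\<integral>z. f z \<partial>lborel)\<bar> \<le> real k * (s * (e / t))" for k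
    proof (induction k)
      case 0
      have "(\<integral>z. Z 0 f z \<partial>lborel) = (\<integral>z. f z \<partial>lborel)"
        using Z_0[of f] L by (intro integral_aeq) (auto intro: L1_Z)
      then show ?case by simp
    next
      case (Suc k)
      let ?t = "real k * s"
      let ?b = "\<lambda>z. Z s f z - f z - s * g z"
      have t0: "0 \<le> ?t" using s by simp
      have Lb: "L1 ?b" using s L by (intro L1_intros L1_Z) auto
      have "aeq (\<lambda>z. Z (?t + s) f z - Z ?t f z) (\<lambda>z. Z ?t ?b z + s * Z ?t g z)"
        using s L t0 by (intro increment_step) auto
      then have "(\<integral>z. Z (?t + s) f z - Z ?t f z \<partial>lborel) = (\<integral>z. Z ?t ?b z + s * Z ?t g z \<partial>lborel)"
        using s t0 L Lb by (intro integral_aeq) (intro L1_intros L1_Z; simp)+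
      also have "\<dots> = (\<integral>z. Z ?t ?b z \<partial>lborel) + s * (\<integral>z. Z ?t g z \<partial>lborel)"
        using L1_Z[OF t0 Lb] L1_Z[OF t0 L(2)] by (simp add: L1_def)
      also have "(\<integral>z. Z ?t g z \<partial>lborel) = 0"
        using null generator_Z[OF gen t0] by blast
      finally have "(\<integral>z. Z (?t + s) f z \<partial>lborel) - (\<integral>z. Z ?t f z \<partial>lborel) = (\<integral>z. Z ?t ?b z \<partial>lborel)"
        using s t0 L by (simp add: integral_L1_diff L1_Z)
      moreover have "\<bar>\<integral>z. Z ?t ?b z \<partial>lborel\<bar> \<le> s * (e / t)"
        using abs_integral_le_l1norm[of "Z ?t ?b"] Z_contr[OF t0 Lb] r(2)[OF s(1,2)] by linarith
      ultimately have "\<bar>(\<integral>z. Z (?t + s) f z \<partial>lborel) - (\<integral>z. f z \<partial>lborel)\<bar> \<le> real k * (s * (e / t)) + s * (e / t)"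
        using Suc by linarith
      then show ?case by (simp add: algebra_simps add_divide_distrib)
    qed
    from this[of N] show "\<bar>(\<integral>z. Z t f z \<partial>lborel) - (\<integral>z. f z \<partial>lborel)\<bar> \<le> 0 + e"
      using s(3) t by (simp add: mult.assoc[symmetric])
  qed
  then show ?thesis by simp
qed

text \<open>The range of \<open>lam - R\<close> is dense, and its witnesses carry no net mass in
  \<open>g\<close>. Dissipativity turns approximation of \<open>lam f - g\<close> into approximation
  of the pair \<open>(f, g)\<close>, so the generator lies in the closure of \<open>R\<close> and
  all its values have integral 0. For conservation, \<open>h\<close> is approximated by some
  \<open>lam f - g\<close>: under \<open>Z t\<close> the mass of \<open>f\<close> is preserved and
  that of \<open>g\<close> stays 0.\<close>

theorem generator_eq_closure_honest:
  assumes ext: "extends_op (generator Z) R" and lam: "0 < lam"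
    and dense: "\<And>h d. L1 h \<Longrightarrow> 0 < d \<Longrightarrow> \<exists>f g. R f g \<and> (\<integral>z. g z \<partial>lborel) = 0
                  \<and> l1norm (\<lambda>z. lam * f z - g z - h z) < d"
  shows "generator Z f g \<longleftrightarrow> op_closure R f g"
    and "0 \<le> t \<Longrightarrow> L1 h \<Longrightarrow> (\<integral>z. Z t h z \<partial>lborel) = (\<integral>z. h z \<partial>lborel)"
proof -
  have approx: "\<exists>fs gs. (\<forall>n. R (fs n) (gs n)) \<and> (\<forall>n. (\<integral>z. gs n z \<partial>lborel) = 0) \<and>
      (\<lambda>n. l1norm (\<lambda>z. fs n z - f z)) \<longlonglongrightarrow> 0 \<and> (\<lambda>n. l1norm (\<lambda>z. gs n z - g z)) \<longlonglongrightarrow> 0"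
    if gen: "generator Z f g" for f g
  proof -
    have L: "L1 f" "L1 g" using gen generator_L1 by auto
    let ?h = "\<lambda>z. lam * f z - g z"
    have "\<forall>n. \<exists>p. R (fst p) (snd p) \<and> (\<integral>z. snd p z \<partial>lborel) = 0
                  \<and> l1norm (\<lambda>z. lam * fst p z - snd p z - ?h z) < inverse (real (Suc n))"
    proof
      fix n
      have "L1 ?h" using L by (intro L1_intros)
      from dense[OF this, of "inverse (real (Suc n))"]
      show "\<exists>p. R (fst p) (snd p) \<and> (\<integral>z. snd p z \<partial>lborel) = 0
                  \<and> l1norm (\<lambda>z. lam * fst p z - snd p z - ?h z) < inverse (real (Suc n))"
        by simp
    qed
    from choice[OF this] obtain p where p: "\<forall>n. R (fst (p n)) (snd (p n)) \<and> (\<integral>z. snd (p n) z \<partial>lborel) = 0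
                  \<and> l1norm (\<lambda>z. lam * fst (p n) z - snd (p n) z - ?h z) < inverse (real (Suc n))" by blast
    define fs gs where "fs = (\<lambda>n. fst (p n))" and "gs = (\<lambda>n. snd (p n))"
    have fg: "R (fs n) (gs n)" "(\<integral>z. gs n z \<partial>lborel) = 0"
      "l1norm (\<lambda>z. lam * fs n z - gs n z - ?h z) < inverse (real (Suc n))" for n
      using p unfolding fs_def gs_def by blast+
    have Ln: "L1 (fs n)" "L1 (gs n)" "generator Z (fs n) (gs n)" for n
      using ext fg(1) generator_L1 unfolding extends_op_def by blast+
    let ?e = "\<lambda>n. l1norm (\<lambda>z. lam * fs n z - gs n z - ?h z)"
    have e: "?e \<longlonglongrightarrow> 0"
      using fg(3) by (intro l1norm_tendsto_zero_squeeze[OF _ LIMSEQ_inverse_real_of_nat])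
        (simp add: less_imp_le)
    \<comment> \<open>Dissipativity is applied to the difference of the approximating pair and the
      given one. This controls the first components, and then \<open>gs n - g\<close> is recovered
      from the resolvent error.\<close>
    have f: "lam * l1norm (\<lambda>z. fs n z - f z) \<le> ?e n" for n
      using generator_dissipative[OF generator_diff[OF Ln(3) gen] lam, of n]
      by (simp add: algebra_simps)
    have "(\<lambda>n. ?e n / lam) \<longlonglongrightarrow> 0 / lam" using lam by (intro tendsto_intros e) auto
    then have e': "(\<lambda>n. ?e n / lam) \<longlonglongrightarrow> 0" by simp
    have F: "(\<lambda>n. l1norm (\<lambda>z. fs n z - f z)) \<longlonglongrightarrow> 0"
      using f lam by (intro l1norm_tendsto_zero_squeeze[OF _ e']) (simp add: pos_le_divide_eq mult.commute)
    have "l1norm (\<lambda>z. gs n z - g z) \<le> lam * l1norm (\<lambda>z. fs n z - f z) + ?e n" for n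
    proof -
      have "l1norm (\<lambda>z. gs n z - g z) = l1norm (\<lambda>z. lam * (fs n z - f z) + (-1) * (lam * fs n z - gs n z - ?h z))"
        by (simp add: algebra_simps)
      also have "\<dots> \<le> l1norm (\<lambda>z. lam * (fs n z - f z)) + l1norm (\<lambda>z. (-1) * (lam * fs n z - gs n z - ?h z))"
        using L Ln by (intro l1norm_triangle) (intro L1_intros; simp)+
      finally show ?thesis using lam by (simp only: l1norm_scale)
    qed
    moreover have "(\<lambda>n. lam * l1norm (\<lambda>z. fs n z - f z) + ?e n) \<longlonglongrightarrow> lam * 0 + 0"
      by (intro tendsto_intros e F)
    ultimately have "(\<lambda>n. l1norm (\<lambda>z. gs n z - g z)) \<longlonglongrightarrow> 0"
      by (intro l1norm_tendsto_zero_squeeze[where u = "\<lambda>n. lam * l1norm (\<lambda>z. fs n z - f z) + ?e n"]) simp_all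
    with fg F show ?thesis by blast
  qed
  show "generator Z f g \<longleftrightarrow> op_closure R f g"
  proof
    assume gen: "generator Z f g"
    then show "op_closure R f g"
      using approx[OF gen] generator_L1[OF gen] unfolding op_closure_def by blast
  next
    assume "op_closure R f g"
    then show "generator Z f g"
      using ext unfolding op_closure_def extends_op_def by (auto intro: generator_closed)
  qed
  have null: "(\<integral>z. g z \<partial>lborel) = 0" if gen: "generator Z f g" for f g
  proof -
    obtain fs gs where fg: "\<And>n. R (fs n) (gs n)" "\<And>n. (\<integral>z. gs n z \<partial>lborel) = 0"
       "(\<lambda>n. l1norm (\<lambda>z. gs n z - g z)) \<longlonglongrightarrow> 0" using approx[OF gen] by blast
    have "\<bar>\<integral>z. g z \<partial>lborel\<bar> \<le> l1norm (\<lambda>z. gs n z - g z)" for n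
    proof -
      have "L1 (gs n)" "L1 g" using ext fg(1) gen generator_L1 unfolding extends_op_def by blast+
      then show ?thesis
        using abs_integral_le_l1norm[of "\<lambda>z. gs n z - g z"] fg(2)[of n] by (simp add: integral_L1_diff)
    qed
    then have "\<bar>\<integral>z. g z \<partial>lborel\<bar> \<le> 0" by (intro LIMSEQ_le_const[OF fg(3)]) auto
    then show ?thesis by simp
  qed
  show "(\<integral>z. Z t h z \<partial>lborel) = (\<integral>z. h z \<partial>lborel)" if t: "0 \<le> t" and h: "L1 h"
  proof -
    have "\<bar>(\<integral>z. Z t h z \<partial>lborel) - (\<integral>z. h z \<partial>lborel)\<bar> \<le> 0"
    proof (rule field_le_epsilon)
      fix e :: real assume "0 < e"
      then obtain f g where fg: "R f g" "(\<integral>z. g z \<partial>lborel) = 0"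
         "l1norm (\<lambda>z. lam * f z - g z - h z) < e / 2" using dense[OF h, of "e / 2"] by auto
      have gen: "generator Z f g" using ext fg(1) unfolding extends_op_def by blast
      have L: "L1 f" "L1 g" using generator_L1[OF gen] by auto
      let ?h = "\<lambda>z. lam * f z - g z"
      have Lh: "L1 ?h" using L by (intro L1_intros)
      have "aeq (Z t ?h) (\<lambda>z. Z t (\<lambda>z. lam * f z) z - Z t g z)"
        using t L by (intro Z_diff L1_scale)
      moreover have "aeq (Z t (\<lambda>z. lam * f z)) (\<lambda>z. lam * Z t f z)"
        using t L by (intro Z_scale)
      ultimately have "aeq (Z t ?h) (\<lambda>z. lam * Z t f z - Z t g z)"
        unfolding aeq_def by eventually_elim simp
      then have "(\<integral>z. Z t ?h z \<partial>lborel) = (\<integral>z. lam * Z t f z - Z t g z \<partial>lborel)"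
        using t L Lh by (intro integral_aeq) (intro L1_intros L1_Z; simp)+
      also have "\<dots> = lam * (\<integral>z. Z t f z \<partial>lborel) - (\<integral>z. Z t g z \<partial>lborel)"
        using L1_Z[OF t] L by (simp add: L1_def)
      also have "(\<integral>z. Z t g z \<partial>lborel) = 0" using null generator_Z[OF gen t] by blast
      also have "(\<integral>z. Z t f z \<partial>lborel) = (\<integral>z. f z \<partial>lborel)"
        by (rule integral_conserved_on_domain[OF gen t]) (rule null)
      also have "lam * (\<integral>z. f z \<partial>lborel) - 0 = (\<integral>z. ?h z \<partial>lborel)"
        using L fg(2) by (simp add: L1_def)
      finally have eq: "(\<integral>z. Z t ?h z \<partial>lborel) = (\<integral>z. ?h z \<partial>lborel)" .
      have "\<bar>(\<integral>z. Z t ?h z \<partial>lborel) - (\<integral>z. Z t h z \<partial>lborel)\<bar> \<le> l1norm (\<lambda>z. Z t ?h z - Z t h z)"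
        using abs_integral_le_l1norm[of "\<lambda>z. Z t ?h z - Z t h z"] L1_Z[OF t Lh] L1_Z[OF t h]
        by (simp add: integral_L1_diff)
      also have "\<dots> \<le> l1norm (\<lambda>z. ?h z - h z)" using t Lh h by (intro Z_contr_diff)
      finally have "\<bar>(\<integral>z. Z t ?h z \<partial>lborel) - (\<integral>z. Z t h z \<partial>lborel)\<bar> < e / 2" using fg(3) by simp
      moreover have "\<bar>(\<integral>z. ?h z \<partial>lborel) - (\<integral>z. h z \<partial>lborel)\<bar> < e / 2"
        using abs_integral_le_l1norm[of "\<lambda>z. ?h z - h z"] integral_L1_diff[OF Lh h] fg(3)
        by simp
      ultimately show "\<bar>(\<integral>z. Z t h z \<partial>lborel) - (\<integral>z. h z \<partial>lborel)\<bar> \<le> 0 + e"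
        using eq by linarith
    qed
    then show ?thesis by simp
  qed
qed

end

section \<open>Changes of variables, the sphere and Gaussian moments\<close>

lemma nn_integral_lborel_translate:
  fixes f :: "'a :: euclidean_space \<Rightarrow> ennreal"
  assumes [measurable]: "f \<in> borel_measurable borel"
  shows "(\<integral>\<^sup>+x. f (x + c) \<partial>lborel) = (\<integral>\<^sup>+x. f x \<partial>lborel)"
proof -
  have "(\<integral>\<^sup>+x. f x \<partial>lborel) = (\<integral>\<^sup>+x. f x \<partial>distr lborel borel ((+) c))"
    by (simp add: lborel_distr_plus)
  also have "\<dots> = (\<integral>\<^sup>+x. f (x + c) \<partial>lborel)"
    by (subst nn_integral_distr) (auto simp: add.commute)
  finally show ?thesis by simp
qed

text \<open>The map has eigenvalue \<open>1 - c\<close> along \<open>n\<close> and 1 on the plane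
  orthogonal to \<open>n\<close>.\<close>

lemma det_rank_one_update:
  fixes n :: "real^3"
  assumes n: "norm n = 1"
  shows "det (matrix (\<lambda>q. q - (c * (q \<bullet> n)) *\<^sub>R n)) = 1 - c"
proof -
  have "n \<bullet> n = 1" using n by (simp add: dot_square_norm)
  then have n1: "n$1 * n$1 + n$2 * n$2 + n$3 * n$3 = 1"
    by (simp add: inner_vec_def sum_3)
  have "det (matrix (\<lambda>q. q - (c * (q \<bullet> n)) *\<^sub>R n)) = 1 - c * (n$1 * n$1 + n$2 * n$2 + n$3 * n$3)"
    unfolding det_3 matrix_def
    by (simp add: inner_axis') (simp add: axis_def algebra_simps)
  then show ?thesis using n1 by simp
qed

lemma nn_integral_rank_one_update:
  fixes n :: "real^3" and f :: "real^3 \<Rightarrow> ennreal"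
  assumes n: "norm n = 1" and c: "c \<noteq> 1" and f[measurable]: "f \<in> borel_measurable borel"
  shows "(\<integral>\<^sup>+q. f (q - (c * (q \<bullet> n)) *\<^sub>R n) \<partial>lborel) = ennreal (1 / \<bar>1 - c\<bar>) * (\<integral>\<^sup>+q. f q \<partial>lborel)"
proof -
  let ?L = "\<lambda>q :: real^3. q - (c * (q \<bullet> n)) *\<^sub>R n"
  \<comment> \<open>The inverse of a rank-one update is again one (Sherman-Morrison);
    \<open>cc\<close> is the condition on the two coefficients.\<close>
  define c' where "c' = - c / (1 - c)"
  let ?L' = "\<lambda>q :: real^3. q - (c' * (q \<bullet> n)) *\<^sub>R n"
  have nn: "n \<bullet> n = 1" using n by (simp add: dot_square_norm)
  have cc: "c + c' - c * c' = 0" using c by (simp add: c'_def field_simps)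
  have det': "1 - c' = 1 / (1 - c)" using c by (simp add: c'_def field_simps)
  have comp: "a * (q \<bullet> n) + b * ((q - (a * (q \<bullet> n)) *\<^sub>R n) \<bullet> n) = (a + b - b * a) * (q \<bullet> n)"
    for a b and q :: "real^3"
    using nn by (simp add: inner_diff_left algebra_simps)
  have LL': "?L (?L' q) = q" for q
  proof -
    have "?L (?L' q) = q - (c' * (q \<bullet> n) + c * (?L' q \<bullet> n)) *\<^sub>R n"
      by (simp only: scaleR_add_left diff_diff_eq)
    also have "c' * (q \<bullet> n) + c * (?L' q \<bullet> n) = 0" using comp[of c' q c] cc by simp
    finally show ?thesis by simp
  qed
  have L'L: "?L' (?L q) = q" for q
  proof -
    have "?L' (?L q) = q - (c * (q \<bullet> n) + c' * (?L q \<bullet> n)) *\<^sub>R n"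
      by (simp only: scaleR_add_left diff_diff_eq)
    also have "c * (q \<bullet> n) + c' * (?L q \<bullet> n) = 0" using comp[of c q c'] cc
      by (simp add: mult.commute add.commute)
    finally show ?thesis by simp
  qed
  have lin: "linear ?L'"
    by (rule linearI) (auto simp: inner_add_left algebra_simps)
  have meas: "?L \<in> borel_measurable borel" by measurable
  \<comment> \<open>Lebesgue measure is recognised by its values on boxes. The preimage of a box
    under \<open>?L\<close> is its image under \<open>?L'\<close>, whose volume carries the
    determinant \<open>1 - c' = 1 / (1 - c)\<close>.\<close>
  have "lborel = density (distr lborel borel ?L) (\<lambda>_. ennreal \<bar>1 - c\<bar>)"
  proof (rule lborel_eqI)
    fix l u :: "real^3" assume lu: "\<And>b. b \<in> Basis \<Longrightarrow> l \<bullet> b \<le> u \<bullet> b"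
    have vim: "?L -` box l u = ?L' ` box l u"
    proof (intro set_eqI iffI)
      fix q assume "q \<in> ?L -` box l u"
      then show "q \<in> ?L' ` box l u" using L'L[of q] by (intro image_eqI[of _ _ "?L q"]) auto
    next
      fix q assume "q \<in> ?L' ` box l u"
      then obtain p where p: "p \<in> box l u" "q = ?L' p" by blast
      have "?L q = p" unfolding p(2) by (rule LL')
      with p(1) show "q \<in> ?L -` box l u" by simp
    qed
    have lm: "?L' ` box l u \<in> lmeasurable"
      by (rule measurable_linear_image[OF lin]) simp
    have "emeasure lborel (?L -` box l u) = emeasure lebesgue (?L' ` box l u)"
      using measurable_sets[OF meas, of "box l u"] unfolding vim by simp
    also have "\<dots> = ennreal (measure lebesgue (?L' ` box l u))"
      using lm by (rule emeasure_eq_measure2)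
    also have "measure lebesgue (?L' ` box l u) = \<bar>1 - c'\<bar> * measure lebesgue (box l u)"
      using measure_linear_image[OF lin, of "box l u"] det_rank_one_update[OF n, of c'] by simp
    finally have e: "emeasure lborel (?L -` box l u) = ennreal (\<bar>1 - c'\<bar> * measure lborel (box l u))"
      by simp
    have "emeasure (density (distr lborel borel ?L) (\<lambda>_. ennreal \<bar>1 - c\<bar>)) (box l u)
        = ennreal \<bar>1 - c\<bar> * emeasure lborel (?L -` box l u)"
      using meas by (simp add: emeasure_density_const emeasure_distr)
    also have "\<dots> = ennreal (measure lborel (box l u))"
      unfolding e using c by (simp add: ennreal_mult[symmetric] det' abs_div)
    also have "\<dots> = (\<Prod>b\<in>Basis. (u - l) \<bullet> b)"
      using lu by (simp add: measure_lborel_box_eq)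
    finally show "emeasure (density (distr lborel borel ?L) (\<lambda>_. ennreal \<bar>1 - c\<bar>)) (box l u)
        = (\<Prod>b\<in>Basis. (u - l) \<bullet> b)" .
  qed simp
  then have "(\<integral>\<^sup>+q. f q \<partial>lborel) = (\<integral>\<^sup>+q. f q \<partial>density (distr lborel borel ?L) (\<lambda>_. ennreal \<bar>1 - c\<bar>))"
    by simp
  also have "\<dots> = ennreal \<bar>1 - c\<bar> * (\<integral>\<^sup>+q. f (?L q) \<partial>lborel)"
    using meas by (simp add: nn_integral_density nn_integral_distr nn_integral_cmult)
  finally have eq: "(\<integral>\<^sup>+q. f q \<partial>lborel) = ennreal \<bar>1 - c\<bar> * (\<integral>\<^sup>+q. f (?L q) \<partial>lborel)" .
  have "ennreal (1 / \<bar>1 - c\<bar>) * ennreal \<bar>1 - c\<bar> = 1"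
    using c by (simp add: ennreal_mult[symmetric])
  then show ?thesis unfolding eq by (simp add: mult.assoc[symmetric])
qed

lemma sets_sphere_meas[simp, measurable_cong]: "sets sphere_meas = sets borel"
  by (simp add: sphere_meas_def)

lemma space_sphere_meas[simp]: "space sphere_meas = UNIV"
  by (simp add: sphere_meas_def)

lemma borel_measurable_cone_density:
  "(\<lambda>y :: vec3. ennreal 3 * indicator (ball 0 1) y) \<in> borel_measurable lborel"
  by (intro borel_measurable_times_ennreal borel_measurable_const borel_measurable_indicator) simp

lemma finite_measure_sphere_meas: "finite_measure sphere_meas"
proof
  have "emeasure sphere_meas UNIV = 3 * emeasure lborel (ball (0 :: vec3) 1)"
    unfolding sphere_meas_def
    using borel_measurable_cone_density
    by (subst emeasure_distr) (auto simp: emeasure_density nn_integral_cmult_indicator)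
  moreover have "emeasure lborel (ball (0 :: vec3) 1) < \<infinity>"
    using emeasure_bounded_finite[of "ball (0 :: vec3) 1"] by simp
  ultimately show "emeasure sphere_meas (space sphere_meas) \<noteq> \<infinity>"
    by (simp add: ennreal_mult_eq_top_iff less_top)
qed

interpretation sphere_meas: finite_measure sphere_meas
  by (rule finite_measure_sphere_meas)

interpretation lborel_sphere: pair_sigma_finite "lborel :: vec3 measure" sphere_meas ..

text \<open>Radial projection sends the origin to 0, since \<open>inverse 0 = 0\<close>; this single
  point is null, so normals are unit vectors only almost everywhere.\<close>

lemma AE_sphere_meas_norm: "AE n in sphere_meas. norm n = 1"
proof -
  have "AE y in lborel. (y :: vec3) \<noteq> 0" by (rule AE_lborel_singleton)
  then have "AE y in density lborel (\<lambda>y :: vec3. ennreal 3 * indicator (ball 0 1) y).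
      norm (y /\<^sub>R norm y) = 1"
    by (subst AE_density[OF borel_measurable_cone_density]) (auto elim!: eventually_mono)
  then show ?thesis unfolding sphere_meas_def
    by (subst AE_distr_iff) auto
qed

section \<open>Moments of the Maxwellian\<close>

lemma nn_integral_inverse_1_plus_square: "(\<integral>\<^sup>+x. ennreal (1 / (1 + x\<^sup>2)) \<partial>lborel) < \<infinity>"
proof -
  let ?f = "\<lambda>x :: real. 1 / (1 + x\<^sup>2)"
  have half: "(\<integral>\<^sup>+x. ennreal (?f x) * indicator {0..} x \<partial>lborel) = ennreal (pi / 2 - arctan 0)"
    by (rule nn_integral_FTC_atLeast)
      (auto intro!: derivative_eq_intros tendsto_arctan_at_top simp: field_simps)
  have neg: "(\<integral>\<^sup>+x. ennreal (?f x) * indicator {..0} x \<partial>lborel) = (\<integral>\<^sup>+x. ennreal (?f x) * indicator {0..} x \<partial>lborel)"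
    by (subst nn_integral_real_affine[of _ "-1" 0]) (auto simp: indicator_def intro!: nn_integral_cong)
  have "(\<integral>\<^sup>+x. ennreal (?f x) \<partial>lborel)
      \<le> (\<integral>\<^sup>+x. ennreal (?f x) * indicator {0..} x + ennreal (?f x) * indicator {..0} x \<partial>lborel)"
    by (intro nn_integral_mono) (auto simp: indicator_def)
  also have "\<dots> = ennreal (pi / 2 - arctan 0) + ennreal (pi / 2 - arctan 0)"
    by (subst nn_integral_add) (auto simp: half neg)
  also have "\<dots> < \<infinity>" by simp
  finally show ?thesis .
qed

text \<open>Trades a radial weight for a product over coordinates, so that integrability on the
  whole space reduces to a one-dimensional arctangent integral.\<close>

lemma prod_Basis_1_plus_square_le:
  fixes w :: vec3
  shows "(\<Prod>b\<in>Basis. 1 + (w \<bullet> b)\<^sup>2) \<le> (1 + (norm w)\<^sup>2) ^ 3"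
proof -
  have "(\<Prod>b\<in>Basis. 1 + (w \<bullet> b)\<^sup>2) \<le> (\<Prod>b\<in>(Basis :: vec3 set). 1 + (norm w)\<^sup>2)"
    by (intro prod_mono) (auto simp: abs_le_square_iff[symmetric] Basis_le_norm)
  then show ?thesis by simp
qed

text \<open>The Gaussian beats the sixth power of \<open>1 + r^2\<close>: three of the factors
  absorb \<open>(1 + r)^3\<close>, the other three form the denominator needed by the product
  majorant. The choice \<open>c = b / 6\<close> makes the sixth power of \<open>exp (c * s)\<close>
  equal to \<open>exp (b * s)\<close>.\<close>

lemma cubic_times_gaussian_bound:
  assumes b: "0 < (b :: real)" and r: "0 \<le> r"
  shows "(1 + r) ^ 3 * exp (- b * r\<^sup>2) \<le> 8 * (1 + 6 / b) ^ 6 / (1 + r\<^sup>2) ^ 3"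
proof -
  define c where "c = b / 6"
  define s where "s = r\<^sup>2"
  have c: "0 < c" using b by (simp add: c_def)
  have s: "0 \<le> s" by (simp add: s_def)
  have "1 + s \<le> (1 + 1 / c) * (1 + c * s)" using c s by (simp add: field_simps)
  also have "\<dots> \<le> (1 + 1 / c) * exp (c * s)" using c by (intro mult_left_mono exp_ge_add_one_self) auto
  finally have "(1 + s) ^ 6 \<le> ((1 + 1 / c) * exp (c * s)) ^ 6" using s by (intro power_mono) auto
  also have "\<dots> = (1 + 6 / b) ^ 6 * exp (b * s)"
    by (simp add: power_mult_distrib c_def exp_of_nat_mult[symmetric])
  finally have 1: "(1 + s) ^ 6 * exp (- b * s) \<le> (1 + 6 / b) ^ 6"
    by (simp add: exp_minus field_simps)
  \<comment> \<open>This square is chosen to give \<open>r <= 2 * r^2 + 1 / 8\<close>, hence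
    \<open>1 + r <= 2 * (1 + r^2)\<close>.\<close>
  have "0 \<le> (r - 1 / 4)\<^sup>2" by simp
  then have "1 + r \<le> 2 * (1 + s)" unfolding s_def by (simp add: power2_eq_square algebra_simps)
  then have "(1 + r) ^ 3 \<le> (2 * (1 + s)) ^ 3" using r by (intro power_mono) auto
  then have "(1 + r) ^ 3 \<le> 8 * (1 + s) ^ 3" by (simp only: power_mult_distrib) simp
  then have "(1 + r) ^ 3 * exp (- b * s) * (1 + s) ^ 3 \<le> 8 * (1 + s) ^ 3 * exp (- b * s) * (1 + s) ^ 3"
    using s by (intro mult_right_mono) auto
  also have "\<dots> = 8 * ((1 + s) ^ 6 * exp (- b * s))"
    by (simp add: power_add[symmetric] mult_ac flip: power_add)
  also have "\<dots> \<le> 8 * (1 + 6 / b) ^ 6" using 1 by simp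
  finally show ?thesis using s unfolding s_def[symmetric]
    by (subst pos_le_divide_eq) auto
qed

lemma Maxw_nonneg: "0 \<le> Maxw m1 u1 th1 w"
  by (simp add: Maxw_def)

lemma borel_measurable_Maxw[measurable]: "Maxw m1 u1 th1 \<in> borel_measurable borel"
  unfolding Maxw_def by measurable

text \<open>Recentring the Gaussian from \<open>u1\<close> to 0 by
  \<open>|w|^2 <= 2 |w - u1|^2 + 2 |u1|^2\<close> costs half of the exponent and the factor
  \<open>exp (a * |u1|^2)\<close>; the remaining half still dominates the cubic weight.\<close>

lemma Maxw_third_moment:
  assumes "0 < m1" "0 < th1"
  shows "(\<integral>\<^sup>+w. ennreal ((1 + norm w) ^ 3 * Maxw m1 u1 th1 w) \<partial>lborel) < \<infinity>"
proof -
  define a where "a = m1 / (2 * th1)"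
  define A where "A = (m1 / (2 * pi * th1)) powr (3/2) * exp (a * (norm u1)\<^sup>2) * (8 * (1 + 6 / (a / 2)) ^ 6)"
  have a: "0 < a" using assms by (simp add: a_def)
  have A: "0 \<le> A" using a by (simp add: A_def)
  have bound: "(1 + norm w) ^ 3 * Maxw m1 u1 th1 w \<le> A * (\<Prod>b\<in>Basis. 1 / (1 + (w \<bullet> b)\<^sup>2))" for w
  proof -
    have "(norm w)\<^sup>2 \<le> (norm (w - u1) + norm u1)\<^sup>2"
      using norm_triangle_ineq[of "w - u1" u1] by (intro power_mono) auto
    also have "\<dots> \<le> 2 * (norm (w - u1))\<^sup>2 + 2 * (norm u1)\<^sup>2"
      using sum_squares_ge_zero[of "norm (w - u1) - norm u1" 0] by (simp add: power2_eq_square algebra_simps)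
    finally have "a * (norm w)\<^sup>2 \<le> a * (2 * (norm (w - u1))\<^sup>2 + 2 * (norm u1)\<^sup>2)"
      using a by (intro mult_left_mono) auto
    then have "- (a * (norm (w - u1))\<^sup>2) \<le> a * (norm u1)\<^sup>2 + (- (a / 2) * (norm w)\<^sup>2)"
      by (simp add: distrib_left)
    moreover have "- m1 * (norm (w - u1))\<^sup>2 / (2 * th1) = - (a * (norm (w - u1))\<^sup>2)"
      by (simp add: a_def)
    ultimately have "exp (- m1 * (norm (w - u1))\<^sup>2 / (2 * th1)) \<le> exp (a * (norm u1)\<^sup>2) * exp (- (a / 2) * (norm w)\<^sup>2)"
      by (simp flip: exp_add)
    then have "(1 + norm w) ^ 3 * Maxw m1 u1 th1 w
        \<le> (1 + norm w) ^ 3 * ((m1 / (2 * pi * th1)) powr (3/2) * (exp (a * (norm u1)\<^sup>2) * exp (- (a / 2) * (norm w)\<^sup>2)))"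
      unfolding Maxw_def by (intro mult_left_mono) auto
    also have "\<dots> = (m1 / (2 * pi * th1)) powr (3/2) * exp (a * (norm u1)\<^sup>2) * ((1 + norm w) ^ 3 * exp (- (a / 2) * (norm w)\<^sup>2))"
      by simp
    also have "\<dots> \<le> (m1 / (2 * pi * th1)) powr (3/2) * exp (a * (norm u1)\<^sup>2) * (8 * (1 + 6 / (a / 2)) ^ 6 / (1 + (norm w)\<^sup>2) ^ 3)"
      using a by (intro mult_left_mono cubic_times_gaussian_bound) auto
    also have "\<dots> = A * (1 / (1 + (norm w)\<^sup>2) ^ 3)" by (simp add: A_def)
    also have "\<dots> \<le> A * (1 / (\<Prod>b\<in>Basis. 1 + (w \<bullet> b)\<^sup>2))"
      using prod_Basis_1_plus_square_le[of w] A
      by (intro mult_left_mono divide_left_mono mult_pos_pos prod_pos) (auto intro: add_pos_nonneg)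
    finally show ?thesis by (simp add: prod_dividef)
  qed
  have "(\<integral>\<^sup>+w. ennreal ((1 + norm w) ^ 3 * Maxw m1 u1 th1 w) \<partial>lborel)
     \<le> (\<integral>\<^sup>+(w :: vec3). ennreal A * (\<Prod>b\<in>Basis. ennreal (1 / (1 + (w \<bullet> b)\<^sup>2))) \<partial>lborel)"
    using bound A by (intro nn_integral_mono) (simp add: prod_ennreal ennreal_mult[symmetric] prod_nonneg)
  also have "\<dots> = ennreal A * (\<Prod>b\<in>(Basis :: vec3 set). (\<integral>\<^sup>+x. ennreal (1 / (1 + x\<^sup>2)) \<partial>lborel))"
    by (subst nn_integral_cmult) (auto simp: nn_integral_lborel_prod[of "\<lambda>b x. ennreal (1 / (1 + x\<^sup>2))"])
  also have "\<dots> < \<infinity>"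
    using nn_integral_inverse_1_plus_square
    by (auto simp: ennreal_mult_less_top ennreal_prod_eq_top power_less_top_ennreal)
  finally show ?thesis .
qed

section \<open>The collision operator and its adjoint\<close>

locale collision =
  fixes m m1 eps th1 :: real and u1 :: vec3
  assumes m: "m > 0" and m1: "m1 > 0" and eps0: "0 < eps" and eps1: "eps < 1" and th1: "th1 > 0"
begin

abbreviation M :: "vec3 \<Rightarrow> real" where "M \<equiv> Maxw m1 u1 th1"

abbreviation sig :: "vec3 \<Rightarrow> real" where "sig \<equiv> coll_freq m1 u1 th1"

abbreviation mu :: "(vec3 \<times> vec3) measure" where "mu \<equiv> lborel \<Otimes>\<^sub>M sphere_meas"

abbreviation vst :: "vec3 \<Rightarrow> vec3 \<times> vec3 \<Rightarrow> vec3" where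
  "vst v p \<equiv> vstar m m1 eps v (fst p) (snd p)"

abbreviation wst :: "vec3 \<Rightarrow> vec3 \<times> vec3 \<Rightarrow> vec3" where
  "wst v p \<equiv> wstar m m1 eps v (fst p) (snd p)"

abbreviation B :: "vec3 \<Rightarrow> vec3 \<times> vec3 \<Rightarrow> real" where
  "B v p \<equiv> \<bar>(v - fst p) \<bullet> snd p\<bar>"

text \<open>Coefficient of the forward collision \<open>vpost\<close>, which multiplies the normal
  relative velocity by \<open>- eps\<close>. The maps \<open>vstar\<close> and \<open>wstar\<close>
  belong to the inverse collision, which multiplies it by \<open>- 1 / eps\<close>; accordingly
  \<open>gam = kap / eps\<close>.\<close>

definition kap :: real where "kap = alpha m m1 * (1 - beta eps)"

definition vpost :: "vec3 \<Rightarrow> vec3 \<times> vec3 \<Rightarrow> vec3" where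
  "vpost v p = v - (2 * kap * ((v - fst p) \<bullet> snd p)) *\<^sub>R snd p"

definition Kadj :: "(vec3 \<Rightarrow> ennreal) \<Rightarrow> vec3 \<Rightarrow> ennreal" where
  "Kadj \<phi> v = (\<integral>\<^sup>+p. ennreal (B v p * M (fst p)) * \<phi> (vpost v p) \<partial>mu)"

text \<open>The gain operator with values in \<open>ennreal\<close>: Tonelli applies without
  integrability conditions, and \<open>Kadj\<close> is its formal adjoint on weights that depend on
  \<open>v\<close> only.\<close>

definition Kpos :: "(phase \<Rightarrow> ennreal) \<Rightarrow> phase \<Rightarrow> ennreal" where
  "Kpos f z = ennreal (eps powr (-2)) *
     (\<integral>\<^sup>+p. ennreal (B (snd z) p * M (wst (snd z) p)) * f (fst z, vst (snd z) p) \<partial>mu)"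

lemma kap_bounds: "0 < kap" "kap < 1"
proof -
  have a: "0 < alpha m m1" "alpha m m1 < 1" using m m1 by (auto simp: alpha_def field_simps)
  have b: "0 < 1 - beta eps" "1 - beta eps < 1" using eps0 eps1 by (auto simp: beta_def field_simps)
  show "0 < kap" unfolding kap_def using a b by simp
  have "alpha m m1 * (1 - beta eps) < 1 * 1" using a b by (intro mult_strict_mono) auto
  then show "kap < 1" by (simp add: kap_def)
qed

lemma restitution: "1 - 2 * beta eps = eps"
  by (simp add: beta_def field_simps)

lemma gam_eq: "2 * gam m m1 eps = 2 * kap / eps"
  by (simp add: gam_def kap_def restitution)

lemma gam_gambar: "2 * gam m m1 eps + 2 * gambar m m1 eps = (1 + eps) / eps"
proof -
  have "2 * gam m m1 eps + 2 * gambar m m1 eps = 2 * (1 - beta eps) / (1 - 2 * beta eps)"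
    unfolding gam_def gambar_def by (simp add: algebra_simps flip: add_divide_distrib)
  moreover have "2 * (1 - beta eps) = 1 + eps" using restitution by simp
  ultimately show ?thesis by (simp only: restitution)
qed

text \<open>For a fixed normal \<open>n\<close>, pass to \<open>(q, w)\<close> with \<open>q = v - w\<close>: the collision is then a
  translation of \<open>w\<close> followed by the linear map \<open>q \<mapsto> q - ((1 + \<epsilon>) / \<epsilon>) (q \<bullet> n) n\<close>,
  whose determinant is \<open>- 1 / \<epsilon>\<close>.\<close>

lemma collision_change_of_variables:
  fixes f \<phi> :: "vec3 \<Rightarrow> ennreal"
  assumes n: "norm n = 1"
    and f[measurable]: "f \<in> borel_measurable borel" and \<phi>[measurable]: "\<phi> \<in> borel_measurable borel"
  shows "ennreal (eps powr (-2)) * (\<integral>\<^sup>+v. \<integral>\<^sup>+w. ennreal (\<bar>(v - w) \<bullet> n\<bar> * M (wstar m m1 eps v w n))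
             * f (vstar m m1 eps v w n) * \<phi> v \<partial>lborel \<partial>lborel)
       = (\<integral>\<^sup>+v. \<integral>\<^sup>+w. ennreal (\<bar>(v - w) \<bullet> n\<bar> * M w) * f v * \<phi> (vpost v (w, n)) \<partial>lborel \<partial>lborel)"
proof -
  define g gb where "g = 2 * gam m m1 eps" and "gb = 2 * gambar m m1 eps"
  define c where "c = (1 + eps) / eps"
  have gc: "g + gb = c" using gam_gambar by (simp add: g_def gb_def c_def)
  have ge: "g * eps = 2 * kap" using gam_eq eps0 by (simp add: g_def)
  have c1: "c \<noteq> 1" "1 / \<bar>1 - c\<bar> = eps" using eps0 by (auto simp: c_def field_simps)
  have nn: "n \<bullet> n = 1" using n by (simp add: dot_square_norm)
  have ee: "ennreal (eps * eps) = ennreal eps * ennreal eps" using eps0 by (simp add: ennreal_mult)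
  let ?L = "\<lambda>q. q - (c * (q \<bullet> n)) *\<^sub>R n"
  let ?G = "\<lambda>p w. ennreal (\<bar>p \<bullet> n\<bar> * M w) * f (p + w) * \<phi> (vpost (p + w) (w, n))"
  let ?H = "\<lambda>v w. ennreal (\<bar>(v - w) \<bullet> n\<bar> * M (wstar m m1 eps v w n)) * f (vstar m m1 eps v w n) * \<phi> v"
  have [measurable]: "(\<lambda>(p, w). ?G p w) \<in> borel_measurable (borel \<Otimes>\<^sub>M borel)"
    unfolding vpost_def fst_conv snd_conv by measurable
  have [measurable]: "(\<lambda>(v, w). ?H v w) \<in> borel_measurable (borel \<Otimes>\<^sub>M borel)"
    unfolding vstar_def wstar_def by measurable
  \<comment> \<open>Shifting \<open>w\<close> by \<open>- gb * (q . n)\<close> along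
    \<open>n\<close> makes \<open>wstar\<close> equal to the new \<open>w\<close> and
    \<open>vstar\<close> equal to \<open>?L q + w\<close>. One factor \<open>eps\<close> comes from
    \<open>|q . n| = eps * |?L q . n|\<close>, a second one later from the Jacobian of
    \<open>?L\<close>; together they cancel \<open>eps powr (-2)\<close>.\<close>
  have key: "?H (q + (w + (- gb * (q \<bullet> n)) *\<^sub>R n)) (w + (- gb * (q \<bullet> n)) *\<^sub>R n) = ennreal eps * ?G (?L q) w" for q w
  proof -
    have Ln: "?L q \<bullet> n = - (q \<bullet> n) / eps"
      using nn eps0 by (simp add: inner_diff_left c_def field_simps)
    have w: "wstar m m1 eps (q + (w + (- gb * (q \<bullet> n)) *\<^sub>R n)) (w + (- gb * (q \<bullet> n)) *\<^sub>R n) n = w"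
      unfolding wstar_def gb_def[symmetric] by (simp add: algebra_simps)
    have "vstar m m1 eps (q + (w + (- gb * (q \<bullet> n)) *\<^sub>R n)) (w + (- gb * (q \<bullet> n)) *\<^sub>R n) n
        = q + w - ((g + gb) * (q \<bullet> n)) *\<^sub>R n"
      unfolding vstar_def g_def[symmetric] by (simp add: algebra_simps)
    also have "\<dots> = ?L q + w" unfolding gc by simp
    finally have v: "vstar m m1 eps (q + (w + (- gb * (q \<bullet> n)) *\<^sub>R n)) (w + (- gb * (q \<bullet> n)) *\<^sub>R n) n = ?L q + w" .
    have "vpost (?L q + w) (w, n) = ?L q + w + (g * (q \<bullet> n)) *\<^sub>R n"
      unfolding vpost_def using Ln ge[symmetric] eps0 by simp
    also have "\<dots> = q + w - ((c - g) * (q \<bullet> n)) *\<^sub>R n" by (simp add: algebra_simps)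
    also have "c - g = gb" using gc by simp
    finally have ph: "vpost (?L q + w) (w, n) = q + (w + (- gb * (q \<bullet> n)) *\<^sub>R n)" by (simp add: algebra_simps)
    have a: "\<bar>q \<bullet> n\<bar> = eps * \<bar>?L q \<bullet> n\<bar>" unfolding Ln using eps0 by simp
    have "ennreal (\<bar>q \<bullet> n\<bar> * M w) = ennreal eps * ennreal (\<bar>?L q \<bullet> n\<bar> * M w)"
      unfolding a using eps0 by (simp add: ennreal_mult[symmetric] Maxw_nonneg mult.assoc)
    then show ?thesis unfolding w v ph by (simp add: mult.assoc)
  qed
  have "(\<integral>\<^sup>+v. \<integral>\<^sup>+w. ?H v w \<partial>lborel \<partial>lborel) = (\<integral>\<^sup>+w. \<integral>\<^sup>+v. ?H v w \<partial>lborel \<partial>lborel)"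
    by (rule lborel_pair.Fubini'[symmetric]) measurable
  also have "\<dots> = (\<integral>\<^sup>+w. \<integral>\<^sup>+q. ?H (q + w) w \<partial>lborel \<partial>lborel)"
    by (intro nn_integral_cong nn_integral_lborel_translate[symmetric]) measurable
  also have "\<dots> = (\<integral>\<^sup>+q. \<integral>\<^sup>+w. ?H (q + w) w \<partial>lborel \<partial>lborel)"
    by (rule lborel_pair.Fubini') measurable
  also have "\<dots> = (\<integral>\<^sup>+q. \<integral>\<^sup>+w. ?H (q + (w + (- gb * (q \<bullet> n)) *\<^sub>R n)) (w + (- gb * (q \<bullet> n)) *\<^sub>R n) \<partial>lborel \<partial>lborel)"
    by (intro nn_integral_cong nn_integral_lborel_translate[symmetric, of "\<lambda>w. ?H (q + w) w" for q]) measurable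
  also have "\<dots> = (\<integral>\<^sup>+q. \<integral>\<^sup>+w. ennreal eps * ?G (?L q) w \<partial>lborel \<partial>lborel)"
    unfolding key ..
  also have "\<dots> = (\<integral>\<^sup>+w. \<integral>\<^sup>+q. ennreal eps * ?G (?L q) w \<partial>lborel \<partial>lborel)"
    by (rule lborel_pair.Fubini'[symmetric]) measurable
  also have "\<dots> = (\<integral>\<^sup>+w. ennreal eps * (ennreal eps * (\<integral>\<^sup>+q. ?G q w \<partial>lborel)) \<partial>lborel)"
    using nn_integral_rank_one_update[OF n c1(1), of "\<lambda>q. ?G q w" for w] unfolding c1(2)
    by (subst nn_integral_cmult) (auto intro!: nn_integral_cong)
  also have "\<dots> = (\<integral>\<^sup>+w. ennreal (eps * eps) * (\<integral>\<^sup>+q. ?G q w \<partial>lborel) \<partial>lborel)"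
    unfolding ee mult.assoc[of "ennreal eps" "ennreal eps"] ..
  also have "\<dots> = ennreal (eps * eps) * (\<integral>\<^sup>+w. \<integral>\<^sup>+q. ?G q w \<partial>lborel \<partial>lborel)"
    by (rule nn_integral_cmult) measurable
  also have "(\<integral>\<^sup>+w. \<integral>\<^sup>+q. ?G q w \<partial>lborel \<partial>lborel) = (\<integral>\<^sup>+w. \<integral>\<^sup>+v. ?G (v + (- w)) w \<partial>lborel \<partial>lborel)"
    by (intro nn_integral_cong nn_integral_lborel_translate[symmetric]) measurable
  also have "\<dots> = (\<integral>\<^sup>+v. \<integral>\<^sup>+w. ?G (v + (- w)) w \<partial>lborel \<partial>lborel)"
    by (rule lborel_pair.Fubini') measurable
  also have "\<dots> = (\<integral>\<^sup>+v. \<integral>\<^sup>+w. ennreal (\<bar>(v - w) \<bullet> n\<bar> * M w) * f v * \<phi> (vpost v (w, n)) \<partial>lborel \<partial>lborel)"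
    by simp
  finally have "(\<integral>\<^sup>+v. \<integral>\<^sup>+w. ?H v w \<partial>lborel \<partial>lborel) = ennreal (eps * eps) *
     (\<integral>\<^sup>+v. \<integral>\<^sup>+w. ennreal (\<bar>(v - w) \<bullet> n\<bar> * M w) * f v * \<phi> (vpost v (w, n)) \<partial>lborel \<partial>lborel)" .
  moreover have "ennreal (eps powr (-2)) * ennreal (eps * eps) = 1"
    using eps0 by (simp add: ennreal_mult[symmetric] powr_minus powr_numeral power2_eq_square field_simps)
  ultimately show ?thesis by (simp add: mult.assoc[symmetric])
qed

lemma Kpos_measurable[measurable]:
  assumes [measurable]: "f \<in> borel_measurable (borel \<Otimes>\<^sub>M borel)"
  shows "Kpos f \<in> borel_measurable (borel \<Otimes>\<^sub>M borel)"
  unfolding Kpos_def vstar_def wstar_def by measurable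

lemma Kadj_measurable[measurable]:
  assumes [measurable]: "\<phi> \<in> borel_measurable borel"
  shows "Kadj \<phi> \<in> borel_measurable borel"
  unfolding Kadj_def vpost_def by measurable

text \<open>The position \<open>x\<close> is a mere parameter of a collision. Tonelli moves the
  normal outermost, and the change of variables applies to almost every normal, namely those of
  length 1.\<close>

lemma Kpos_duality:
  fixes f :: "phase \<Rightarrow> ennreal" and \<phi> :: "vec3 \<Rightarrow> ennreal"
  assumes f: "f \<in> borel_measurable borel" and \<phi>[measurable]: "\<phi> \<in> borel_measurable borel"
  shows "(\<integral>\<^sup>+z. Kpos f z * \<phi> (snd z) \<partial>lborel) = (\<integral>\<^sup>+z. f z * Kadj \<phi> (snd z) \<partial>lborel)"
proof -
  have f[measurable]: "f \<in> borel_measurable (borel \<Otimes>\<^sub>M borel)" using f by (simp add: borel_prod)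
  let ?H = "\<lambda>x v p. ennreal (B v p * M (wst v p)) * f (x, vst v p) * \<phi> v"
  have [measurable]: "(\<lambda>(x, v, p). ennreal (B v p * M (wst v p)) * f (x, vst v p))
      \<in> borel_measurable (borel \<Otimes>\<^sub>M borel \<Otimes>\<^sub>M (borel \<Otimes>\<^sub>M borel))"
    unfolding vstar_def wstar_def by measurable
  let ?G = "\<lambda>x v p. ennreal (B v p * M (fst p)) * f (x, v) * \<phi> (vpost v p)"
  have [measurable]: "(\<lambda>(x, v, p). ?H x v p) \<in> borel_measurable (borel \<Otimes>\<^sub>M borel \<Otimes>\<^sub>M (borel \<Otimes>\<^sub>M borel))"
    unfolding vstar_def wstar_def by measurable
  have [measurable]: "(\<lambda>(x, v, p). ?G x v p) \<in> borel_measurable (borel \<Otimes>\<^sub>M borel \<Otimes>\<^sub>M (borel \<Otimes>\<^sub>M borel))"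
    unfolding vpost_def by measurable
  let ?c = "ennreal (eps powr (-2))"
  have swap: "(\<integral>\<^sup>+v. \<integral>\<^sup>+p. F v p \<partial>mu \<partial>lborel) = (\<integral>\<^sup>+n. \<integral>\<^sup>+v. \<integral>\<^sup>+w. F v (w, n) \<partial>lborel \<partial>lborel \<partial>sphere_meas)"
    if [measurable]: "(\<lambda>(v, p). F v p) \<in> borel_measurable (borel \<Otimes>\<^sub>M (borel \<Otimes>\<^sub>M borel))"
    for F :: "vec3 \<Rightarrow> vec3 \<times> vec3 \<Rightarrow> ennreal"
  proof -
    have "(\<integral>\<^sup>+v. \<integral>\<^sup>+p. F v p \<partial>mu \<partial>lborel) = (\<integral>\<^sup>+v. \<integral>\<^sup>+n. \<integral>\<^sup>+w. F v (w, n) \<partial>lborel \<partial>sphere_meas \<partial>lborel)"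
      by (intro nn_integral_cong lborel_sphere.nn_integral_snd[symmetric]) measurable
    also have "\<dots> = (\<integral>\<^sup>+n. \<integral>\<^sup>+v. \<integral>\<^sup>+w. F v (w, n) \<partial>lborel \<partial>lborel \<partial>sphere_meas)"
      by (rule lborel_sphere.Fubini'[symmetric]) measurable
    finally show ?thesis .
  qed
  have inner: "(\<integral>\<^sup>+v. Kpos f (x, v) * \<phi> v \<partial>lborel) = (\<integral>\<^sup>+v. f (x, v) * Kadj \<phi> v \<partial>lborel)" for x
  proof -
    have "(\<integral>\<^sup>+v. Kpos f (x, v) * \<phi> v \<partial>lborel) = (\<integral>\<^sup>+v. ?c * (\<integral>\<^sup>+p. ?H x v p \<partial>mu) \<partial>lborel)"
      unfolding Kpos_def fst_conv snd_conv mult.assoc[of ?c]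
      by (intro nn_integral_cong arg_cong[where f = "(*) ?c"] nn_integral_multc[symmetric]) measurable
    also have "\<dots> = ?c * (\<integral>\<^sup>+v. (\<integral>\<^sup>+p. ?H x v p \<partial>mu) \<partial>lborel)"
      by (rule nn_integral_cmult) measurable
    also have "(\<integral>\<^sup>+v. (\<integral>\<^sup>+p. ?H x v p \<partial>mu) \<partial>lborel) = (\<integral>\<^sup>+n. \<integral>\<^sup>+v. \<integral>\<^sup>+w. ?H x v (w, n) \<partial>lborel \<partial>lborel \<partial>sphere_meas)"
      by (rule swap) measurable
    also have "?c * \<dots> = (\<integral>\<^sup>+n. ?c * (\<integral>\<^sup>+v. \<integral>\<^sup>+w. ?H x v (w, n) \<partial>lborel \<partial>lborel) \<partial>sphere_meas)"
      by (rule nn_integral_cmult[symmetric]) measurable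
    also have "\<dots> = (\<integral>\<^sup>+n. \<integral>\<^sup>+v. \<integral>\<^sup>+w. ?G x v (w, n) \<partial>lborel \<partial>lborel \<partial>sphere_meas)"
    proof (rule nn_integral_cong_AE)
      show "AE n in sphere_meas. ?c * (\<integral>\<^sup>+v. \<integral>\<^sup>+w. ?H x v (w, n) \<partial>lborel \<partial>lborel)
         = (\<integral>\<^sup>+v. \<integral>\<^sup>+w. ?G x v (w, n) \<partial>lborel \<partial>lborel)"
        using AE_sphere_meas_norm
      proof eventually_elim
        case (elim n)
        from collision_change_of_variables[OF elim, of "\<lambda>v. f (x, v)" \<phi>] show ?case by simp
      qed
    qed
    also have "\<dots> = (\<integral>\<^sup>+v. \<integral>\<^sup>+p. ?G x v p \<partial>mu \<partial>lborel)"
      by (rule swap[symmetric]) measurable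
    also have "\<dots> = (\<integral>\<^sup>+v. f (x, v) * Kadj \<phi> v \<partial>lborel)"
      unfolding Kadj_def vpost_def
      by (intro nn_integral_cong) (simp add: nn_integral_cmult[symmetric] mult_ac)
    finally show ?thesis .
  qed
  have "(\<integral>\<^sup>+z. Kpos f z * \<phi> (snd z) \<partial>lborel) = (\<integral>\<^sup>+x. \<integral>\<^sup>+v. Kpos f (x, v) * \<phi> v \<partial>lborel \<partial>lborel)"
    unfolding lborel_prod[symmetric] by (subst lborel.nn_integral_fst[symmetric]) auto
  also have "\<dots> = (\<integral>\<^sup>+x. \<integral>\<^sup>+v. f (x, v) * Kadj \<phi> v \<partial>lborel \<partial>lborel)"
    unfolding inner ..
  also have "\<dots> = (\<integral>\<^sup>+z. f z * Kadj \<phi> (snd z) \<partial>lborel)"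
    unfolding lborel_prod[symmetric] by (subst lborel.nn_integral_fst[symmetric]) auto
  finally show ?thesis .
qed

section \<open>The moment constant and the collision frequency\<close>

definition mom :: real where
  "mom = enn2real (\<integral>\<^sup>+p. ennreal ((1 + norm (fst p)) ^ 3 * M (fst p)) \<partial>mu)"

lemma mom: "(\<integral>\<^sup>+p. ennreal ((1 + norm (fst p)) ^ 3 * M (fst p)) \<partial>mu) = ennreal mom"
  and mom_nonneg: "0 \<le> mom"
proof -
  have fin: "emeasure sphere_meas UNIV < \<infinity>"
    using sphere_meas.emeasure_finite less_top unfolding infinity_ennreal_def by blast
  have "(\<integral>\<^sup>+p. ennreal ((1 + norm (fst p)) ^ 3 * M (fst p)) \<partial>mu)
     = (\<integral>\<^sup>+w. \<integral>\<^sup>+n. ennreal ((1 + norm w) ^ 3 * M w) \<partial>sphere_meas \<partial>lborel)"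
    by (subst sphere_meas.nn_integral_fst[symmetric]) auto
  also have "\<dots> = (\<integral>\<^sup>+w. ennreal ((1 + norm w) ^ 3 * M w) \<partial>lborel) * emeasure sphere_meas UNIV"
    by (simp add: nn_integral_multc)
  also have "\<dots> < \<infinity>"
    using Maxw_third_moment[OF m1 th1] fin by (auto simp: ennreal_mult_less_top)
  finally show "(\<integral>\<^sup>+p. ennreal ((1 + norm (fst p)) ^ 3 * M (fst p)) \<partial>mu) = ennreal mom"
    by (simp add: mom_def less_top)
  show "0 \<le> mom" by (simp add: mom_def)
qed

lemma AE_mu_norm: "AE p in mu. norm (snd p) = 1"
proof (rule lborel_sphere.AE_pair_measure)
  have "Measurable.pred mu (\<lambda>p. norm (snd p) = 1)" by measurable
  then show "{p \<in> space mu. norm (snd p) = 1} \<in> sets mu" by (simp only: pred_def)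
qed (use AE_sphere_meas_norm in simp)

text \<open>Deliberately coarse: the factor in \<open>w\<close> has the form integrated in
  \<open>mom\<close>, so that one constant serves both the collision rate and the energy
  remainder.\<close>

lemma B_le: "norm (snd p) = 1 \<Longrightarrow> B v p \<le> (1 + norm v) * (1 + norm (fst p)) ^ 3"
proof -
  assume n: "norm (snd p) = 1"
  have "B v p \<le> norm (v - fst p)" using Cauchy_Schwarz_ineq2[of "v - fst p" "snd p"] n by simp
  also have "\<dots> \<le> norm v + norm (fst p)" by (rule norm_triangle_ineq4)
  also have "\<dots> \<le> (1 + norm v) * (1 + norm (fst p))" by (simp add: algebra_simps)
  also have "\<dots> \<le> (1 + norm v) * (1 + norm (fst p)) ^ 3"
    by (intro mult_left_mono self_le_power) auto
  finally show ?thesis .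
qed

lemma collision_rate_le: "(\<integral>\<^sup>+p. ennreal (B v p * M (fst p)) \<partial>mu) \<le> ennreal ((1 + norm v) * mom)"
proof -
  have "(\<integral>\<^sup>+p. ennreal (B v p * M (fst p)) \<partial>mu)
     \<le> (\<integral>\<^sup>+p. ennreal (1 + norm v) * ennreal ((1 + norm (fst p)) ^ 3 * M (fst p)) \<partial>mu)"
    using AE_mu_norm
  proof (intro nn_integral_mono_AE, eventually_elim)
    case (elim p)
    have "B v p * M (fst p) \<le> (1 + norm v) * (1 + norm (fst p)) ^ 3 * M (fst p)"
      using B_le[OF elim(2)] by (rule mult_right_mono) (rule Maxw_nonneg)
    then show ?case by (simp add: ennreal_mult[symmetric] Maxw_nonneg mult.assoc ennreal_leI del: ennreal_plus)
  qed
  also have "\<dots> = ennreal ((1 + norm v) * mom)"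
    by (subst nn_integral_cmult) (auto simp: mom ennreal_mult mom_nonneg simp del: ennreal_plus)
  finally show ?thesis .
qed

text \<open>Finiteness from \<open>collision_rate_le\<close> rules out the default value 0 of the
  integral in \<open>coll_freq\<close>, so it agrees with the nonnegative integral.\<close>

lemma ennreal_sig: "(\<integral>\<^sup>+p. ennreal (B v p * M (fst p)) \<partial>mu) = ennreal (sig v)"
  and sig_nonneg: "0 \<le> sig v" and sig_le: "sig v \<le> (1 + norm v) * mom"
proof -
  have "integrable mu (\<lambda>p. B v p * M (fst p))"
    using collision_rate_le[of v]
    by (intro integrableI_nonneg) (auto simp: Maxw_nonneg less_top[symmetric] top_unique intro: le_less_trans)
  then show e: "(\<integral>\<^sup>+p. ennreal (B v p * M (fst p)) \<partial>mu) = ennreal (sig v)"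
    unfolding coll_freq_def by (intro nn_integral_eq_integral) (auto simp: Maxw_nonneg)
  show "0 \<le> sig v" unfolding coll_freq_def by (intro integral_nonneg_AE) (auto simp: Maxw_nonneg)
  show "sig v \<le> (1 + norm v) * mom"
    using collision_rate_le[of v] e mom_nonneg by (simp add: ennreal_le_iff)
qed

lemma borel_measurable_sig[measurable]: "sig \<in> borel_measurable borel"
  unfolding coll_freq_def by measurable

text \<open>With a constant weight the outgoing velocity disappears. Through duality this is
  conservation of particle number: the total gain equals the total loss.\<close>

lemma Kadj_one: "Kadj (\<lambda>_. 1) v = ennreal (sig v)"
  unfolding Kadj_def by (simp add: ennreal_sig)

section \<open>Energy weight and its dissipation in collisions\<close>

definition psi :: "vec3 \<Rightarrow> real" where "psi v = 1 + (norm v)\<^sup>2"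

lemma psi_ge_1: "1 \<le> psi v"
  by (simp add: psi_def)

lemma borel_measurable_psi[measurable]: "psi \<in> borel_measurable borel"
  unfolding psi_def by measurable

lemma sig_le_psi: "sig v \<le> 2 * mom * psi v"
proof -
  have "0 \<le> (norm v - 1 / 4)\<^sup>2" by simp
  then have "1 + norm v \<le> 2 * psi v"
    unfolding psi_def by (simp add: power2_eq_square algebra_simps)
  then have "(1 + norm v) * mom \<le> 2 * psi v * mom" using mom_nonneg by (rule mult_right_mono)
  with sig_le[of v] show ?thesis by (simp add: algebra_simps)
qed

text \<open>With \<open>a = q \<bullet> n\<close> and \<open>b = w \<bullet> n\<close> the energy gain is \<open>- 4 \<kappa> (1 - \<kappa>) a\<^sup>2 - 4 \<kappa> a b\<close>,
  which is negative once \<open>\<bar>a\<bar> > \<bar>b\<bar> / (1 - \<kappa>)\<close>.\<close>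

lemma psi_vpost:
  assumes n: "norm (snd p) = 1"
  shows "B v p * psi (vpost v p) \<le> B v p * psi v + 4 * kap / (1 - kap)\<^sup>2 * (1 + norm (fst p)) ^ 3"
proof -
  obtain w n where p: "p = (w, n)" by force
  define a b where "a = (v - w) \<bullet> n" and "b = w \<bullet> n"
  have nn: "n \<bullet> n = 1" using n p by (simp add: dot_square_norm)
  have vn: "v \<bullet> n = a + b" by (simp add: a_def b_def inner_diff_left)
  have "(norm (vpost v p))\<^sup>2 = (v - (2 * kap * a) *\<^sub>R n) \<bullet> (v - (2 * kap * a) *\<^sub>R n)"
    by (simp add: vpost_def p a_def power2_norm_eq_inner)
  also have "\<dots> = (norm v)\<^sup>2 - 4 * kap * a * (v \<bullet> n) + 4 * kap\<^sup>2 * a\<^sup>2 * (n \<bullet> n)"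
    unfolding power2_norm_eq_inner by (simp add: inner_diff_left inner_diff_right inner_commute[of n v] power2_eq_square algebra_simps)
  also have "\<dots> = (norm v)\<^sup>2 - 4 * kap * (1 - kap) * a\<^sup>2 - 4 * kap * a * b"
    unfolding nn vn by (simp add: power2_eq_square algebra_simps)
  finally have gain: "psi (vpost v p) = psi v - 4 * kap * ((1 - kap) * a\<^sup>2 + a * b)"
    by (simp add: psi_def algebra_simps)
  have k: "0 < kap" "0 < 1 - kap" using kap_bounds by auto
  have bw: "\<bar>b\<bar> \<le> norm w" unfolding b_def using Cauchy_Schwarz_ineq2[of w n] n p by simp
  \<comment> \<open>The kernel contributes one more factor \<open>|a|\<close>. The gain is positive
    only where \<open>|a|\<close> is below \<open>|b| / (1 - kap)\<close>, and there the product is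
    at most \<open>|b|^3 / (1 - kap)^2\<close>: the origin of the third moment and of the constant
    in \<open>lam\<close>.\<close>
  have "\<bar>a\<bar> * - ((1 - kap) * a\<^sup>2 + a * b) \<le> \<bar>b\<bar> ^ 3 / (1 - kap)\<^sup>2"
  proof -
    have "- (a * b) \<le> \<bar>a\<bar> * \<bar>b\<bar>" by (metis abs_ge_minus_self abs_mult)
    then have 1: "- ((1 - kap) * a\<^sup>2 + a * b) \<le> \<bar>a\<bar> * (\<bar>b\<bar> - (1 - kap) * \<bar>a\<bar>)"
      by (simp add: power2_eq_square algebra_simps)
    have 2: "\<bar>a\<bar> * - ((1 - kap) * a\<^sup>2 + a * b) \<le> \<bar>a\<bar> * (\<bar>a\<bar> * (\<bar>b\<bar> - (1 - kap) * \<bar>a\<bar>))"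
      using 1 by (rule mult_left_mono) simp
    show ?thesis
    proof (cases "\<bar>a\<bar> \<le> \<bar>b\<bar> / (1 - kap)")
      case True
      have "\<bar>a\<bar> * (\<bar>a\<bar> * (\<bar>b\<bar> - (1 - kap) * \<bar>a\<bar>)) \<le> \<bar>a\<bar> * (\<bar>a\<bar> * \<bar>b\<bar>)"
        using k by (intro mult_left_mono) auto
      also have "\<dots> \<le> (\<bar>b\<bar> / (1 - kap)) * ((\<bar>b\<bar> / (1 - kap)) * \<bar>b\<bar>)"
        using True k by (intro mult_mono) auto
      also have "\<dots> = \<bar>b\<bar> ^ 3 / (1 - kap)\<^sup>2" by (simp add: power2_eq_square power3_eq_cube)
      finally show ?thesis using 2 by linarith
    next
      case False
      then have "\<bar>b\<bar> - (1 - kap) * \<bar>a\<bar> \<le> 0" using k by (simp add: field_simps)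
      then have "\<bar>a\<bar> * (\<bar>a\<bar> * (\<bar>b\<bar> - (1 - kap) * \<bar>a\<bar>)) \<le> 0" by (intro mult_nonneg_nonpos) auto
      moreover have "0 \<le> \<bar>b\<bar> ^ 3 / (1 - kap)\<^sup>2" by simp
      ultimately show ?thesis using 2 by linarith
    qed
  qed
  also have "\<dots> \<le> (1 + norm w) ^ 3 / (1 - kap)\<^sup>2"
    using bw by (intro divide_right_mono power_mono) auto
  finally have "4 * kap * (\<bar>a\<bar> * - ((1 - kap) * a\<^sup>2 + a * b)) \<le> 4 * kap * ((1 + norm w) ^ 3 / (1 - kap)\<^sup>2)"
    using k by (intro mult_left_mono) auto
  moreover have "B v p = \<bar>a\<bar>" by (simp add: p a_def)
  ultimately show ?thesis unfolding gain by (simp add: p algebra_simps)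
qed

text \<open>The first summand is the integrated remainder of \<open>psi_vpost\<close>. The extra 1
  leaves one copy of \<open>psi\<close> to spare in the energy balance, which pays for
  \<open>wt (Rf h)\<close> in \<open>iteration_step\<close>.\<close>

definition lam :: real where "lam = 4 * kap / (1 - kap)\<^sup>2 * mom + 1"

lemma lam_ge_1: "1 \<le> lam"
  using kap_bounds mom_nonneg by (simp add: lam_def)

text \<open>\<open>psi_vpost\<close> integrated against the Maxwellian; its constant remainder is at
  most \<open>(lam - 1) * psi v\<close> because \<open>1 <= psi v\<close>.\<close>

lemma Kadj_psi: "Kadj (\<lambda>v. ennreal (psi v)) v \<le> ennreal ((sig v + lam - 1) * psi v)"
proof -
  let ?D = "4 * kap / (1 - kap)\<^sup>2"
  have D: "0 \<le> ?D" using kap_bounds by simp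
  have "Kadj (\<lambda>v. ennreal (psi v)) v
     \<le> (\<integral>\<^sup>+p. ennreal (psi v) * ennreal (B v p * M (fst p)) + ennreal ?D * ennreal ((1 + norm (fst p)) ^ 3 * M (fst p)) \<partial>mu)"
    unfolding Kadj_def using AE_mu_norm
  proof (intro nn_integral_mono_AE, eventually_elim)
    case (elim p)
    have "B v p * psi (vpost v p) * M (fst p) \<le> (B v p * psi v + ?D * (1 + norm (fst p)) ^ 3) * M (fst p)"
      using psi_vpost[OF elim(2)] by (rule mult_right_mono) (rule Maxw_nonneg)
    then have "ennreal (B v p * M (fst p) * psi (vpost v p)) \<le> ennreal (psi v * (B v p * M (fst p)) + ?D * ((1 + norm (fst p)) ^ 3 * M (fst p)))"
      by (intro ennreal_leI) (simp add: algebra_simps)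
    then show ?case using D less_imp_le[OF kap_bounds(1)] psi_ge_1[of v] psi_ge_1[of "vpost v p"]
      by (simp add: ennreal_mult[symmetric] ennreal_plus[symmetric] Maxw_nonneg del: ennreal_plus)
  qed
  also have "\<dots> = ennreal (psi v) * ennreal (sig v) + ennreal ?D * ennreal mom"
    by (subst nn_integral_add) (auto simp: nn_integral_cmult ennreal_sig mom)
  also have "\<dots> = ennreal (psi v * sig v + ?D * mom)"
    using D less_imp_le[OF kap_bounds(1)] psi_ge_1[of v] sig_nonneg[of v] mom_nonneg
    by (simp add: ennreal_mult[symmetric] ennreal_plus[symmetric] del: ennreal_plus)
  also have "\<dots> \<le> ennreal ((sig v + lam - 1) * psi v)"
  proof (intro ennreal_leI)
    have "?D * mom * 1 \<le> ?D * mom * psi v"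
      using D mom_nonneg psi_ge_1 by (intro mult_left_mono mult_nonneg_nonneg)
    then show "psi v * sig v + ?D * mom \<le> (sig v + lam - 1) * psi v"
      by (simp add: lam_def algebra_simps)
  qed
  finally show ?thesis .
qed

end

section \<open>Free transport with absorption\<close>

lemma borel_measurable_fst'[measurable (raw)]:
  fixes f :: "'a \<Rightarrow> 'b :: second_countable_topology \<times> 'c :: second_countable_topology"
  assumes "f \<in> borel_measurable N"
  shows "(\<lambda>x. fst (f x)) \<in> borel_measurable N"
  using assms by (rule borel_measurable_continuous_on[rotated]) (auto intro!: continuous_intros)

lemma borel_measurable_snd'[measurable (raw)]:
  fixes f :: "'a \<Rightarrow> 'b :: second_countable_topology \<times> 'c :: second_countable_topology"
  assumes "f \<in> borel_measurable N"
  shows "(\<lambda>x. snd (f x)) \<in> borel_measurable N"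
  using assms by (rule borel_measurable_continuous_on[rotated]) (auto intro!: continuous_intros)

text \<open>For each fixed velocity this is a translation in position.\<close>

lemma nn_integral_free_transport:
  fixes g :: "phase \<Rightarrow> ennreal"
  assumes g: "g \<in> borel_measurable borel"
  shows "(\<integral>\<^sup>+z. g (fst z + t *\<^sub>R snd z, snd z) \<partial>lborel) = (\<integral>\<^sup>+z. g z \<partial>lborel)"
proof -
  have [measurable]: "g \<in> borel_measurable (borel \<Otimes>\<^sub>M borel)" using g by (simp add: borel_prod)
  have "(\<integral>\<^sup>+z. g (fst z + t *\<^sub>R snd z, snd z) \<partial>lborel) = (\<integral>\<^sup>+v. \<integral>\<^sup>+x. g (x + t *\<^sub>R v, v) \<partial>lborel \<partial>lborel)"
    unfolding lborel_prod[symmetric] by (subst lborel_pair.nn_integral_snd[symmetric]) auto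
  also have "\<dots> = (\<integral>\<^sup>+v. \<integral>\<^sup>+x. g (x, v) \<partial>lborel \<partial>lborel)"
    by (intro nn_integral_cong nn_integral_lborel_translate) measurable
  also have "\<dots> = (\<integral>\<^sup>+z. g z \<partial>lborel)"
    unfolding lborel_prod[symmetric] by (subst lborel_pair.nn_integral_snd[symmetric]) auto
  finally show ?thesis .
qed

text \<open>Obtained from invariance of the measure itself, so it holds for signed \<open>g\<close>
  whether or not the integrals converge.\<close>

lemma integral_free_transport:
  fixes g :: "phase \<Rightarrow> real"
  assumes g[measurable]: "g \<in> borel_measurable borel"
  shows "(\<integral>z. g (fst z + t *\<^sub>R snd z, snd z) \<partial>lborel) = (\<integral>z. g z \<partial>lborel)"
proof -
  let ?S = "\<lambda>z :: phase. (fst z + t *\<^sub>R snd z, snd z)"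
  have S[measurable]: "?S \<in> measurable lborel borel" by measurable
  have "distr lborel borel ?S = lborel"
  proof (rule measure_eqI)
    fix A assume "A \<in> sets (distr lborel borel ?S)"
    then have A[measurable]: "A \<in> sets borel" by simp
    have "emeasure (distr lborel borel ?S) A = (\<integral>\<^sup>+z. indicator A z \<partial>distr lborel borel ?S)"
      by simp
    also have "\<dots> = (\<integral>\<^sup>+z. indicator A (?S z) \<partial>lborel)"
      by (rule nn_integral_distr) auto
    also have "\<dots> = emeasure lborel A"
      by (subst nn_integral_free_transport) auto
    finally show "emeasure (distr lborel borel ?S) A = emeasure lborel A" .
  qed simp
  then have "(\<integral>z. g z \<partial>lborel) = (\<integral>z. g z \<partial>distr lborel borel ?S)" by simp
  also have "\<dots> = (\<integral>z. g (?S z) \<partial>lborel)"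
    by (rule integral_distr) auto
  finally show ?thesis by simp
qed

lemma nn_integral_exponential:
  assumes a: "0 < (a :: real)"
  shows "(\<integral>\<^sup>+t. ennreal (a * exp (- a * t)) * indicator {0..} t \<partial>lborel) = 1"
proof -
  have "(\<integral>\<^sup>+t. ennreal (a * exp (- a * t)) * indicator {0..} t \<partial>lborel) = ennreal (0 - (- exp (- a * 0)))"
  proof (rule nn_integral_FTC_atLeast)
    have "filterlim (\<lambda>t. a * t) at_top at_top"
      using a by (rule filterlim_tendsto_pos_mult_at_top[OF tendsto_const _ filterlim_ident])
    then have "((\<lambda>t. exp (- (a * t))) \<longlongrightarrow> 0) at_top"
      by (intro filterlim_compose[OF exp_at_bot] filterlim_compose[OF filterlim_uminus_at_bot_at_top])
    from tendsto_minus[OF this] show "((\<lambda>t. - exp (- a * t)) \<longlongrightarrow> 0) at_top" by simp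
  qed (use a in \<open>auto intro!: derivative_eq_intros\<close>)
  then show ?thesis by simp
qed

text \<open>The integrand is the derivative of \<open>- exp (- a * t) * g t\<close>, which tends to
  0 at infinity because \<open>g\<close> is bounded. Along a characteristic \<open>g\<close> will be
  a test function.\<close>

lemma integral_exponential_FTC:
  fixes g g' :: "real \<Rightarrow> real"
  assumes a: "0 < a" and g: "\<And>t. (g has_real_derivative g' t) (at t)"
    and cont: "continuous_on UNIV g'"
    and bg: "\<And>t. \<bar>g t\<bar> \<le> C" and bg': "\<And>t. \<bar>g' t\<bar> \<le> C'"
  shows "(\<integral>t. indicator {0..} t * (exp (- a * t) * (a * g t - g' t)) \<partial>lborel) = g 0"
proof -
  let ?f = "\<lambda>t. exp (- a * t) * (a * g t - g' t)"
  let ?F = "\<lambda>t. - exp (- a * t) * g t"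
  have cg: "continuous_on UNIV g"
    using g by (meson DERIV_isCont continuous_at_imp_continuous_on)
  have [measurable]: "g \<in> borel_measurable borel" "g' \<in> borel_measurable borel"
    using cg cont by (auto intro: borel_measurable_continuous_onI)
  have bound: "\<bar>?f t\<bar> \<le> (C + C' / a) * (a * exp (- a * t))" for t
  proof -
    have "\<bar>a * g t - g' t\<bar> \<le> a * \<bar>g t\<bar> + \<bar>g' t\<bar>" using a by (simp add: abs_mult order_trans[OF abs_triangle_ineq4])
    also have "\<dots> \<le> a * C + C'" using a by (intro add_mono mult_left_mono bg bg') auto
    finally have "\<bar>?f t\<bar> \<le> exp (- a * t) * (a * C + C')"
      by (simp add: abs_mult)
    also have "\<dots> = (C + C' / a) * (a * exp (- a * t))" using a by (simp add: field_simps)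
    finally show ?thesis .
  qed
  have int: "integrable lborel (\<lambda>t. indicator {0..} t * (a * exp (- a * t)))"
  proof (rule integrableI_nonneg)
    have "(\<integral>\<^sup>+t. ennreal (indicator {0..} t * (a * exp (- a * t))) \<partial>lborel)
      = (\<integral>\<^sup>+t. ennreal (a * exp (- a * t)) * indicator {0..} t \<partial>lborel)"
      by (intro nn_integral_cong) (simp add: indicator_def)
    then show "(\<integral>\<^sup>+t. ennreal (indicator {0..} t * (a * exp (- a * t))) \<partial>lborel) < \<infinity>"
      using nn_integral_exponential[OF a] by simp
  qed (use a in \<open>auto simp: indicator_def\<close>)
  have int_f: "integrable lborel (\<lambda>t. indicator {0..} t * ?f t)"
  proof (rule Bochner_Integration.integrable_bound)
    show "integrable lborel (\<lambda>t. (C + C' / a) * (indicator {0..} t * (a * exp (- a * t))))"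
      using int by (rule integrable_mult_right)
    show "AE t in lborel. norm (indicator {0..} t * ?f t) \<le> norm ((C + C' / a) * (indicator {0..} t * (a * exp (- a * t))))"
      using bound by (intro AE_I2) (auto simp: indicator_def intro: order_trans[OF _ abs_ge_self])
  qed measurable
  have "(LBINT t=0..\<infinity>. ?f t) = 0 - ?F 0"
  proof (rule interval_integral_FTC_integrable)
    show "(?F has_vector_derivative ?f t) (at t)" for t
      unfolding has_real_derivative_iff_has_vector_derivative[symmetric]
      by (auto intro!: derivative_eq_intros g simp: algebra_simps)
    show "isCont ?f t" for t
      using cg cont by (intro continuous_intros) (auto simp: continuous_on_eq_continuous_at)
    have "set_integrable lborel {0..} ?f" using int_f by (simp add: set_integrable_def)
    then show "set_integrable lborel (einterval 0 \<infinity>) ?f"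
      by (rule set_integrable_subset) (auto simp: einterval_def)
    have "isCont ?F 0" using cg by (intro continuous_intros) (auto simp: continuous_on_eq_continuous_at)
    then have "(?F \<longlongrightarrow> ?F 0) (at_right 0)" unfolding isCont_def by (rule filterlim_mono) (auto simp: at_le)
    then show "((?F \<circ> real_of_ereal) \<longlongrightarrow> ?F 0) (at_right 0)"
      unfolding zero_ereal_def ereal_tendsto_simps1(2) .
    have "filterlim (\<lambda>t. a * t) at_top at_top"
      using a by (rule filterlim_tendsto_pos_mult_at_top[OF tendsto_const _ filterlim_ident])
    then have "((\<lambda>t. exp (- (a * t))) \<longlongrightarrow> 0) at_top"
      by (intro filterlim_compose[OF exp_at_bot] filterlim_compose[OF filterlim_uminus_at_bot_at_top])
    then have "((\<lambda>t. C * exp (- (a * t))) \<longlongrightarrow> C * 0) at_top" by (intro tendsto_intros)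
    then have "(?F \<longlongrightarrow> 0) at_top"
      by (intro Lim_null_comparison[of ?F "\<lambda>t. C * exp (- (a * t))"] always_eventually)
        (auto simp: abs_mult mult.commute[of C] intro!: mult_left_mono bg)
    then show "((?F \<circ> real_of_ereal) \<longlongrightarrow> 0) (at_left \<infinity>)"
      by (simp add: ereal_tendsto_simps1)
  qed simp
  moreover have "(LBINT t=0..\<infinity>. ?f t) = (\<integral>t. indicator {0..} t * ?f t \<partial>lborel)"
  proof -
    have "(LBINT t=0..\<infinity>. ?f t) = (\<integral>t. indicator {0<..} t * ?f t \<partial>lborel)"
      by (simp add: interval_lebesgue_integral_0_infty set_lebesgue_integral_def)
    also have "\<dots> = (\<integral>t. indicator {0..} t * ?f t \<partial>lborel)"
      using AE_lborel_singleton[of "0 :: real"]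
      by (intro integral_cong_AE) (auto elim!: eventually_mono simp: indicator_def)
    finally show ?thesis .
  qed
  ultimately show ?thesis by simp
qed

text \<open>Facts used in the weak formulation; \<open>D\<close> is the derivative
  \<open>v . grad_x\<close> of the test function. Although \<open>v\<close> is unbounded,
  \<open>D\<close> is bounded: it is continuous and vanishes off the compact support.\<close>

lemma test_fun_props:
  assumes "test_fun \<phi>"
  defines "D \<equiv> \<lambda>z. frechet_derivative \<phi> (at z) (snd z, 0)"
  shows "continuous_on UNIV \<phi>" and "continuous_on UNIV D"
    and "\<exists>C. \<forall>z. \<bar>\<phi> z\<bar> \<le> C" and "\<exists>C. \<forall>z. \<bar>D z\<bar> \<le> C"
    and "((\<lambda>t. \<phi> (fst z + t *\<^sub>R snd z, snd z)) has_real_derivative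
            D (fst z + t *\<^sub>R snd z, snd z)) (at t)"
proof -
  have C1: "Ck 1 \<phi>" and cpt: "compact (closure {z. \<phi> z \<noteq> 0})"
    using assms unfolding test_fun_def by auto
  then show c: "continuous_on UNIV \<phi>" by simp
  have diff: "\<phi> differentiable (at z)" for z using C1 by (cases z) simp
  have part: "continuous_on UNIV (\<lambda>z. frechet_derivative \<phi> (at z) i)" if "i \<in> Basis" for i
    using C1 that by simp
  have lin: "linear (frechet_derivative \<phi> (at z))" for z
    using diff by (rule linear_frechet_derivative)
  \<comment> \<open>\<open>Ck\<close> speaks of basis directions only, so the derivative in the
    varying direction \<open>(v, 0)\<close> is expanded in partial derivatives to get
    continuity.\<close>
  have D_sum: "D = (\<lambda>z. \<Sum>i\<in>Basis. ((snd z, 0) \<bullet> i) * frechet_derivative \<phi> (at z) i)"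
  proof
    fix z
    have "D z = frechet_derivative \<phi> (at z) (\<Sum>i\<in>Basis. ((snd z, 0) \<bullet> i) *\<^sub>R i)"
      unfolding D_def by (simp only: euclidean_representation)
    also have "\<dots> = (\<Sum>i\<in>Basis. ((snd z, 0) \<bullet> i) * frechet_derivative \<phi> (at z) i)"
      by (simp add: linear_sum[OF lin] linear_cmul[OF lin])
    finally show "D z = (\<Sum>i\<in>Basis. ((snd z, 0) \<bullet> i) * frechet_derivative \<phi> (at z) i)" .
  qed
  show cD: "continuous_on UNIV D"
    unfolding D_sum by (intro continuous_intros part)
  let ?S = "closure {z. \<phi> z \<noteq> 0}"
  have phi0: "\<phi> z = 0" if "z \<notin> ?S" for z
    using closure_subset[of "{z. \<phi> z \<noteq> 0}"] that by blast
  have D0: "D z = 0" if "z \<notin> ?S" for z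
  proof -
    have "((\<lambda>_. 0) has_derivative (\<lambda>_. 0)) (at z)" by simp
    then have "(\<phi> has_derivative (\<lambda>_. 0)) (at z)"
    proof (rule has_derivative_transform_within_open[where s = "- ?S"])
      show "open (- ?S)" by (intro open_Compl closed_closure)
      show "z \<in> - ?S" using that by simp
      show "0 = \<phi> y" if "y \<in> - ?S" for y using phi0[of y] that by simp
    qed
    then show ?thesis unfolding D_def by (simp add: frechet_derivative_at[symmetric])
  qed
  have bdd: "\<exists>C. \<forall>z. \<bar>h z\<bar> \<le> C" if h: "continuous_on UNIV h" and h0: "\<And>z. z \<notin> ?S \<Longrightarrow> h z = 0"
    for h :: "phase \<Rightarrow> real"
  proof -
    have "bounded (h ` ?S)"
      using h cpt by (intro compact_imp_bounded compact_continuous_image) (auto intro: continuous_on_subset)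
    then obtain C where C: "\<And>z. z \<in> ?S \<Longrightarrow> \<bar>h z\<bar> \<le> C" by (auto simp: bounded_iff)
    have "\<bar>h z\<bar> \<le> max C 0" for z using C[of z] h0[of z] by (cases "z \<in> ?S") auto
    then show ?thesis by blast
  qed
  show "\<exists>C. \<forall>z. \<bar>\<phi> z\<bar> \<le> C" by (intro bdd c phi0)
  show "\<exists>C. \<forall>z. \<bar>D z\<bar> \<le> C" by (intro bdd cD D0)
  have "((\<lambda>t. (fst z + t *\<^sub>R snd z, snd z)) has_derivative (\<lambda>h. (h *\<^sub>R snd z, 0))) (at t)"
    by (auto intro!: derivative_eq_intros)
  moreover have "(\<phi> has_derivative frechet_derivative \<phi> (at (fst z + t *\<^sub>R snd z, snd z)))
      (at (fst z + t *\<^sub>R snd z, snd z))"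
    using diff by (simp add: frechet_derivative_works)
  ultimately have "((\<lambda>t. \<phi> (fst z + t *\<^sub>R snd z, snd z)) has_derivative
     (\<lambda>h. frechet_derivative \<phi> (at (fst z + t *\<^sub>R snd z, snd z)) (h *\<^sub>R snd z, 0))) (at t)"
    by (rule has_derivative_compose)
  moreover have "frechet_derivative \<phi> (at (fst z + t *\<^sub>R snd z, snd z)) (h *\<^sub>R snd z, 0)
     = h * D (fst z + t *\<^sub>R snd z, snd z)" for h
    using linear_cmul[OF lin, of "(fst z + t *\<^sub>R snd z, snd z)" h "(snd z, 0)"]
    by (simp add: D_def scaleR_prod_def)
  ultimately show "((\<lambda>t. \<phi> (fst z + t *\<^sub>R snd z, snd z)) has_real_derivative
            D (fst z + t *\<^sub>R snd z, snd z)) (at t)"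
    by (simp add: has_field_derivative_def mult.commute[of _ "D _"])
qed

context collision
begin

section \<open>The resolvent of transport with absorption\<close>

abbreviation rate :: "vec3 \<Rightarrow> real" where "rate v \<equiv> lam + sig v"

lemma rate_ge_1: "1 \<le> rate v"
  using lam_ge_1 sig_nonneg[of v] by linarith

text \<open>The Laplace transform at \<open>lam\<close> of the absorption semigroup
  \<open>V\<close>, that is, the resolvent of \<open>A\<close>, in \<open>ennreal\<close>
  form.\<close>

definition Rpos :: "(phase \<Rightarrow> ennreal) \<Rightarrow> phase \<Rightarrow> ennreal" where
  "Rpos f z = (\<integral>\<^sup>+t. ennreal (exp (- rate (snd z) * t)) * indicator {0..} t
                  * f (fst z - t *\<^sub>R snd z, snd z) \<partial>lborel)"

lemma Rpos_measurable[measurable]: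
  assumes [measurable]: "f \<in> borel_measurable borel"
  shows "Rpos f \<in> borel_measurable borel"
  unfolding Rpos_def by measurable

text \<open>At each time the transport is undone by invariance of the measure, the weight depending
  on \<open>v\<close> only. What remains is the exponential density
  \<open>rate * exp (- rate * t)\<close>, of mass 1.\<close>

lemma Rpos_duality:
  fixes f :: "phase \<Rightarrow> ennreal"
  assumes f[measurable]: "f \<in> borel_measurable borel" and g[measurable]: "g \<in> borel_measurable borel"
  shows "(\<integral>\<^sup>+z. g (snd z) * ennreal (rate (snd z)) * Rpos f z \<partial>lborel) = (\<integral>\<^sup>+z. g (snd z) * f z \<partial>lborel)"
proof -
  let ?k = "\<lambda>v t. ennreal (rate v * exp (- rate v * t)) * indicator {0..} t"
  have r: "ennreal (rate v) * ennreal (exp (- rate v * t)) = ennreal (rate v * exp (- rate v * t))" for v t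
    using rate_ge_1[of v] by (intro ennreal_mult[symmetric]) auto
  have "(\<integral>\<^sup>+z. g (snd z) * ennreal (rate (snd z)) * Rpos f z \<partial>lborel)
     = (\<integral>\<^sup>+z. \<integral>\<^sup>+t. g (snd z) * ?k (snd z) t * f (fst z - t *\<^sub>R snd z, snd z) \<partial>lborel \<partial>lborel)"
    unfolding Rpos_def r[symmetric]
    by (intro nn_integral_cong) (subst nn_integral_cmult[symmetric], measurable, simp add: mult_ac)
  also have "\<dots> = (\<integral>\<^sup>+t. \<integral>\<^sup>+z. g (snd z) * ?k (snd z) t * f (fst z - t *\<^sub>R snd z, snd z) \<partial>lborel \<partial>lborel)"
    by (rule lborel_pair.Fubini') measurable
  also have "\<dots> = (\<integral>\<^sup>+t. \<integral>\<^sup>+z. g (snd z) * ?k (snd z) t * f z \<partial>lborel \<partial>lborel)"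
  proof (rule nn_integral_cong)
    fix t
    show "(\<integral>\<^sup>+z. g (snd z) * ?k (snd z) t * f (fst z - t *\<^sub>R snd z, snd z) \<partial>lborel)
       = (\<integral>\<^sup>+z. g (snd z) * ?k (snd z) t * f z \<partial>lborel)"
      using nn_integral_free_transport[of "\<lambda>z. g (snd z) * ?k (snd z) t * f z" "- t"] by simp
  qed
  also have "\<dots> = (\<integral>\<^sup>+z. \<integral>\<^sup>+t. g (snd z) * ?k (snd z) t * f z \<partial>lborel \<partial>lborel)"
    by (rule lborel_pair.Fubini'[symmetric]) measurable
  also have "\<dots> = (\<integral>\<^sup>+z. g (snd z) * f z \<partial>lborel)"
  proof (rule nn_integral_cong)
    fix z
    have "(\<integral>\<^sup>+t. g (snd z) * ?k (snd z) t * f z \<partial>lborel) = (\<integral>\<^sup>+t. (g (snd z) * f z) * ?k (snd z) t \<partial>lborel)"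
      by (simp add: mult_ac)
    also have "\<dots> = (g (snd z) * f z) * (\<integral>\<^sup>+t. ?k (snd z) t \<partial>lborel)"
      by (rule nn_integral_cmult) measurable
    also have "(\<integral>\<^sup>+t. ?k (snd z) t \<partial>lborel) = 1"
      using rate_ge_1[of "snd z"] by (intro nn_integral_exponential) auto
    finally show "(\<integral>\<^sup>+t. g (snd z) * ?k (snd z) t * f z \<partial>lborel) = g (snd z) * f z" by simp
  qed
  finally show ?thesis .
qed

end

context collision
begin

text \<open>Meant for \<open>f >= 0\<close>, since \<open>ennreal\<close> cuts off negative values.
  Points where \<open>Rpos\<close> is infinite get the value 0; by \<open>AE_Rf\<close> they form a
  null set when \<open>f\<close> has finite integral.\<close>

definition Rf :: "fn \<Rightarrow> fn" where
  "Rf f z = enn2real (Rpos (\<lambda>z. ennreal (f z)) z)"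

lemma Rf_nonneg: "0 \<le> Rf f z"
  by (simp add: Rf_def)

lemma Rf_measurable[measurable]:
  assumes [measurable]: "f \<in> borel_measurable borel"
  shows "Rf f \<in> borel_measurable borel"
  unfolding Rf_def by measurable

text \<open>True at every point: on divergence both \<open>enn2real\<close> and the integral give
  0.\<close>

lemma Rf_eq_integral:
  assumes [measurable]: "f \<in> borel_measurable borel" and nn: "\<And>z. 0 \<le> f z"
  shows "Rf f z = (\<integral>t. indicator {0..} t * (exp (- rate (snd z) * t) * f (fst z - t *\<^sub>R snd z, snd z)) \<partial>lborel)"
proof -
  have "(\<integral>t. indicator {0..} t * (exp (- rate (snd z) * t) * f (fst z - t *\<^sub>R snd z, snd z)) \<partial>lborel)
      = enn2real (\<integral>\<^sup>+t. ennreal (indicator {0..} t * (exp (- rate (snd z) * t) * f (fst z - t *\<^sub>R snd z, snd z))) \<partial>lborel)"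
    using nn by (intro integral_eq_nn_integral) auto
  also have "\<dots> = Rf f z"
    unfolding Rf_def Rpos_def using nn
    by (intro arg_cong[where f = enn2real] nn_integral_cong) (auto simp: indicator_def ennreal_mult)
  finally show ?thesis by simp
qed

lemma AE_Rf:
  assumes [measurable]: "f \<in> borel_measurable borel" and fin: "(\<integral>\<^sup>+z. ennreal (f z) \<partial>lborel) < \<infinity>"
  shows "AE z in lborel. ennreal (Rf f z) = Rpos (\<lambda>z. ennreal (f z)) z"
proof -
  let ?F = "\<lambda>z. ennreal (rate (snd z)) * Rpos (\<lambda>z. ennreal (f z)) z"
  have "(\<integral>\<^sup>+z. ?F z \<partial>lborel) \<noteq> \<infinity>"
    using Rpos_duality[of "\<lambda>z. ennreal (f z)" "\<lambda>_. 1"] fin by simp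
  then have "AE z in lborel. ?F z \<noteq> \<infinity>" by (intro nn_integral_PInf_AE) auto
  then show ?thesis
  proof eventually_elim
    case (elim z)
    have "ennreal (rate (snd z)) \<noteq> 0" using rate_ge_1[of "snd z"] by simp
    with elim have "Rpos (\<lambda>z. ennreal (f z)) z \<noteq> \<infinity>" by (auto simp: ennreal_mult_eq_top_iff)
    then show ?case by (simp add: Rf_def less_top)
  qed
qed

text \<open>Serves twice: \<open>g = 1\<close> gives the mass balance of the resolvent,
  \<open>g = psi\<close> its energy balance.\<close>

lemma Rf_moment:
  assumes [measurable]: "f \<in> borel_measurable borel" "g \<in> borel_measurable borel"
    and nn: "\<And>z. 0 \<le> f z" "\<And>v. 0 \<le> g v" and fin: "(\<integral>\<^sup>+z. ennreal (f z) \<partial>lborel) < \<infinity>"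
  shows "(\<integral>\<^sup>+z. ennreal (g (snd z) * rate (snd z) * Rf f z) \<partial>lborel) = (\<integral>\<^sup>+z. ennreal (g (snd z) * f z) \<partial>lborel)"
proof -
  have "(\<integral>\<^sup>+z. ennreal (g (snd z) * rate (snd z) * Rf f z) \<partial>lborel)
     = (\<integral>\<^sup>+z. ennreal (g (snd z)) * ennreal (rate (snd z)) * Rpos (\<lambda>z. ennreal (f z)) z \<partial>lborel)"
  proof (rule nn_integral_cong_AE)
    show "AE z in lborel. ennreal (g (snd z) * rate (snd z) * Rf f z)
        = ennreal (g (snd z)) * ennreal (rate (snd z)) * Rpos (\<lambda>z. ennreal (f z)) z"
      using AE_Rf[OF assms(1) fin]
    proof eventually_elim
      case (elim z)
      then show ?case using nn rate_ge_1[of "snd z"] Rf_nonneg[of f z]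
        by (simp add: ennreal_mult' ennreal_mult'' flip: elim)
    qed
  qed
  also have "\<dots> = (\<integral>\<^sup>+z. ennreal (g (snd z)) * ennreal (f z) \<partial>lborel)"
    by (rule Rpos_duality[of _ "\<lambda>v. ennreal (g v)"]) auto
  finally show ?thesis using nn by (simp add: ennreal_mult)
qed

lemma Rf_integrability:
  assumes f: "L1 f" and nn: "\<And>z. 0 \<le> f z"
  shows L1_rate_Rf: "L1 (\<lambda>z. rate (snd z) * Rf f z)"
    and L1_Rf: "L1 (Rf f)" and L1_sig_Rf: "L1 (\<lambda>z. sig (snd z) * Rf f z)"
    and integral_rate_Rf: "(\<integral>z. rate (snd z) * Rf f z \<partial>lborel) = (\<integral>z. f z \<partial>lborel)"
proof -
  have [measurable]: "f \<in> borel_measurable borel" using f by (simp add: L1_def)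
  have fin: "(\<integral>\<^sup>+z. ennreal (f z) \<partial>lborel) < \<infinity>"
    using f nn by (simp add: L1_def nn_integral_eq_integral)
  have eq: "(\<integral>\<^sup>+z. ennreal (rate (snd z) * Rf f z) \<partial>lborel) = (\<integral>\<^sup>+z. ennreal (f z) \<partial>lborel)"
    using Rf_moment[of f "\<lambda>_. 1"] nn fin by simp
  have nnr: "0 \<le> rate (snd z) * Rf f z" for z using rate_ge_1[of "snd z"] Rf_nonneg[of f z] by simp
  show L: "L1 (\<lambda>z. rate (snd z) * Rf f z)"
    unfolding L1_def using eq fin nnr by (intro integrableI_nonneg) auto
  show "(\<integral>z. rate (snd z) * Rf f z \<partial>lborel) = (\<integral>z. f z \<partial>lborel)"
    using eq nnr nn by (simp add: integral_eq_nn_integral)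
  show "L1 (Rf f)"
    unfolding L1_def
  proof (rule Bochner_Integration.integrable_bound[OF L[unfolded L1_def]])
    show "AE z in lborel. norm (Rf f z) \<le> norm (rate (snd z) * Rf f z)"
    proof (intro AE_I2)
      fix z
      have "1 * Rf f z \<le> rate (snd z) * Rf f z"
        using rate_ge_1 Rf_nonneg by (intro mult_right_mono)
      then show "norm (Rf f z) \<le> norm (rate (snd z) * Rf f z)"
        using nnr[of z] Rf_nonneg[of f z] by simp
    qed
  qed measurable
  show "L1 (\<lambda>z. sig (snd z) * Rf f z)"
    unfolding L1_def
  proof (rule Bochner_Integration.integrable_bound[OF L[unfolded L1_def]])
    show "AE z in lborel. norm (sig (snd z) * Rf f z) \<le> norm (rate (snd z) * Rf f z)"
      using nnr sig_nonneg Rf_nonneg[of f] lam_ge_1 by (intro AE_I2) (auto simp: intro!: mult_right_mono)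
  qed measurable
qed

text \<open>The weak form of \<open>(lam - A) R f = f\<close>. After Fubini and a shift along
  characteristics, the time integral acts on the test function alone and
  \<open>integral_exponential_FTC\<close> returns its value at time 0.\<close>

lemma Rf_weak:
  assumes f: "L1 f" and nn: "\<And>z. 0 \<le> f z" and \<phi>: "test_fun \<phi>"
  shows "(\<integral>z. Rf f z * (rate (snd z) * \<phi> z - frechet_derivative \<phi> (at z) (snd z, 0)) \<partial>lborel)
       = (\<integral>z. f z * \<phi> z \<partial>lborel)"
proof -
  let ?D = "\<lambda>z. frechet_derivative \<phi> (at z) (snd z, 0)"
  let ?\<chi> = "\<lambda>z. rate (snd z) * \<phi> z - ?D z"
  note props = test_fun_props[OF \<phi>]
  obtain C where C: "\<And>z. \<bar>\<phi> z\<bar> \<le> C" using props(3) by blast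
  obtain C' where C': "\<And>z. \<bar>?D z\<bar> \<le> C'" using props(4) by blast
  have C0: "0 \<le> C" "0 \<le> C'" using C[of undefined] C'[of undefined] by linarith+
  have [measurable]: "f \<in> borel_measurable borel" using f by (simp add: L1_def)
  have [measurable]: "\<phi> \<in> borel_measurable borel" "?D \<in> borel_measurable borel"
    using props by (auto intro: borel_measurable_continuous_onI)
  have fin: "(\<integral>\<^sup>+z. ennreal (f z) \<partial>lborel) < \<infinity>"
    using f nn by (simp add: L1_def nn_integral_eq_integral)
  \<comment> \<open>The factor \<open>rate\<close> is unbounded, so \<open>?\<chi>\<close> is not
    bounded. This bound is still good enough, because \<open>rate * exp (- rate * t)\<close> has
    mass 1 for every velocity.\<close>
  have chi: "\<bar>?\<chi> z\<bar> \<le> (C + C') * rate (snd z)" for z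
  proof -
    have "\<bar>?\<chi> z\<bar> \<le> \<bar>rate (snd z) * \<phi> z\<bar> + \<bar>?D z\<bar>" by (rule abs_triangle_ineq4)
    also have "\<dots> \<le> rate (snd z) * C + rate (snd z) * C'"
    proof (rule add_mono)
      show "\<bar>rate (snd z) * \<phi> z\<bar> \<le> rate (snd z) * C"
        using C[of z] rate_ge_1[of "snd z"] by (simp add: abs_mult mult_left_mono)
      have "1 * C' \<le> rate (snd z) * C'" using rate_ge_1[of "snd z"] C0 by (intro mult_right_mono)
      with C'[of z] show "\<bar>?D z\<bar> \<le> rate (snd z) * C'" by simp
    qed
    finally show ?thesis by (simp add: algebra_simps)
  qed
  let ?e = "\<lambda>v t. indicator {0..} t * exp (- rate v * t)"
  let ?X = "\<lambda>t z. ?e (snd z) t * f (fst z - t *\<^sub>R snd z, snd z) * ?\<chi> z"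
  let ?Y = "\<lambda>t z. ?e (snd z) t * f z * ?\<chi> (fst z + t *\<^sub>R snd z, snd z)"
  \<comment> \<open>Absolute convergence is checked where \<open>f\<close> is evaluated at the fixed
    point \<open>z\<close>, and is then carried over to \<open>?X\<close> by free transport.\<close>
  have Yfin: "(\<integral>\<^sup>+t. \<integral>\<^sup>+z. ennreal \<bar>?Y t z\<bar> \<partial>lborel \<partial>lborel) < \<infinity>"
  proof -
    let ?k = "\<lambda>v t. ennreal (rate v * exp (- rate v * t)) * indicator {0..} t"
    have "(\<integral>\<^sup>+t. \<integral>\<^sup>+z. ennreal \<bar>?Y t z\<bar> \<partial>lborel \<partial>lborel)
       \<le> (\<integral>\<^sup>+t. \<integral>\<^sup>+z. ennreal ((C + C') * f z) * ?k (snd z) t \<partial>lborel \<partial>lborel)"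
    proof (intro nn_integral_mono)
      fix t :: real and z :: phase
      let ?z = "(fst z + t *\<^sub>R snd z, snd z)"
      have "\<bar>?Y t z\<bar> = ?e (snd z) t * f z * \<bar>?\<chi> ?z\<bar>" using nn by (simp add: abs_mult)
      also have "\<dots> \<le> ?e (snd z) t * f z * ((C + C') * rate (snd z))"
        using chi[of ?z] nn[of z] by (intro mult_left_mono) auto
      finally have "ennreal \<bar>?Y t z\<bar> \<le> ennreal (?e (snd z) t * f z * ((C + C') * rate (snd z)))"
        by (rule ennreal_leI)
      also have "\<dots> = ennreal ((C + C') * f z) * ?k (snd z) t"
        using nn[of z] C0 rate_ge_1[of "snd z"]
        by (cases "t \<ge> 0") (simp_all add: ennreal_mult[symmetric] mult_ac)
      finally show "ennreal \<bar>?Y t z\<bar> \<le> ennreal ((C + C') * f z) * ?k (snd z) t" .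
    qed
    also have "\<dots> = (\<integral>\<^sup>+z. \<integral>\<^sup>+t. ennreal ((C + C') * f z) * ?k (snd z) t \<partial>lborel \<partial>lborel)"
      by (rule lborel_pair.Fubini'[symmetric]) measurable
    also have "\<dots> = (\<integral>\<^sup>+z. ennreal ((C + C') * f z) \<partial>lborel)"
    proof (rule nn_integral_cong)
      fix z :: phase
      have "(\<integral>\<^sup>+t. ennreal ((C + C') * f z) * ?k (snd z) t \<partial>lborel) = ennreal ((C + C') * f z) * (\<integral>\<^sup>+t. ?k (snd z) t \<partial>lborel)"
        by (rule nn_integral_cmult) measurable
      also have "(\<integral>\<^sup>+t. ?k (snd z) t \<partial>lborel) = 1"
        using rate_ge_1[of "snd z"] by (intro nn_integral_exponential) auto
      finally show "(\<integral>\<^sup>+t. ennreal ((C + C') * f z) * ?k (snd z) t \<partial>lborel) = ennreal ((C + C') * f z)" by simp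
    qed
    also have "\<dots> = ennreal (C + C') * (\<integral>\<^sup>+z. ennreal (f z) \<partial>lborel)"
      using C0 nn by (simp add: ennreal_mult nn_integral_cmult del: ennreal_plus)
    also have "\<dots> < \<infinity>" using fin by (simp add: ennreal_mult_less_top)
    finally show ?thesis .
  qed
  have Xfin: "(\<integral>\<^sup>+t. \<integral>\<^sup>+z. ennreal \<bar>?X t z\<bar> \<partial>lborel \<partial>lborel) < \<infinity>"
  proof -
    have "(\<integral>\<^sup>+z. ennreal \<bar>?X t z\<bar> \<partial>lborel) = (\<integral>\<^sup>+z. ennreal \<bar>?Y t z\<bar> \<partial>lborel)" for t
      using nn_integral_free_transport[of "\<lambda>z. ennreal \<bar>?X t z\<bar>" t] by simp
    with Yfin show ?thesis by simp
  qed
  have int: "integrable (lborel \<Otimes>\<^sub>M lborel) (\<lambda>(t, z). U t z)"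
    if U[measurable]: "(\<lambda>(t, z). U t z) \<in> borel_measurable (lborel \<Otimes>\<^sub>M lborel)"
      and fin: "(\<integral>\<^sup>+t. \<integral>\<^sup>+z. ennreal \<bar>U t z\<bar> \<partial>lborel \<partial>lborel) < \<infinity>" for U :: "real \<Rightarrow> phase \<Rightarrow> real"
  proof (rule integrableI_bounded)
    have "(\<integral>\<^sup>+p. ennreal (norm (case p of (t, z) \<Rightarrow> U t z)) \<partial>(lborel \<Otimes>\<^sub>M lborel))
       = (\<integral>\<^sup>+t. \<integral>\<^sup>+z. ennreal \<bar>U t z\<bar> \<partial>lborel \<partial>lborel)"
      by (subst lborel.nn_integral_fst[symmetric]) auto
    with fin show "(\<integral>\<^sup>+p. ennreal (norm (case p of (t, z) \<Rightarrow> U t z)) \<partial>(lborel \<Otimes>\<^sub>M lborel)) < \<infinity>" by simp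
  qed (rule U)
  have "(\<integral>z. Rf f z * ?\<chi> z \<partial>lborel) = (\<integral>z. (\<integral>t. ?X t z \<partial>lborel) \<partial>lborel)"
    by (subst Rf_eq_integral) (simp_all add: nn mult.assoc flip: integral_mult_left_zero)
  also have "\<dots> = (\<integral>t. (\<integral>z. ?X t z \<partial>lborel) \<partial>lborel)"
    by (rule lborel_pair.Fubini_integral, rule int[OF _ Xfin]) measurable
  also have "\<dots> = (\<integral>t. (\<integral>z. ?Y t z \<partial>lborel) \<partial>lborel)"
  proof (rule Bochner_Integration.integral_cong[OF refl])
    fix t
    show "(\<integral>z. ?X t z \<partial>lborel) = (\<integral>z. ?Y t z \<partial>lborel)"
      using integral_free_transport[of "?X t" t] by simp
  qed
  also have "\<dots> = (\<integral>z. (\<integral>t. ?Y t z \<partial>lborel) \<partial>lborel)"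
    by (rule lborel_pair.Fubini_integral[symmetric], rule int[OF _ Yfin]) measurable
  also have "\<dots> = (\<integral>z. f z * \<phi> z \<partial>lborel)"
  proof (rule Bochner_Integration.integral_cong[OF refl])
    fix z :: phase
    let ?z = "\<lambda>t. (fst z + t *\<^sub>R snd z, snd z)"
    have "(\<integral>t. ?Y t z \<partial>lborel)
      = (\<integral>t. f z * (indicator {0..} t * (exp (- rate (snd z) * t) * (rate (snd z) * \<phi> (?z t) - ?D (?z t)))) \<partial>lborel)"
      by (simp add: mult_ac)
    also have "\<dots> = f z * (\<integral>t. indicator {0..} t * (exp (- rate (snd z) * t) * (rate (snd z) * \<phi> (?z t) - ?D (?z t))) \<partial>lborel)"
      by (rule integral_mult_right_zero)
    also have "(\<integral>t. indicator {0..} t * (exp (- rate (snd z) * t) * (rate (snd z) * \<phi> (?z t) - ?D (?z t))) \<partial>lborel) = \<phi> (?z 0)"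
    proof (rule integral_exponential_FTC)
      show "0 < rate (snd z)" using rate_ge_1[of "snd z"] by linarith
      show "((\<lambda>t. \<phi> (?z t)) has_real_derivative ?D (?z t)) (at t)" for t by (rule props(5))
      show "continuous_on UNIV (\<lambda>t. ?D (?z t))"
        by (rule continuous_on_compose2[OF props(2)]) (auto intro!: continuous_intros)
      show "\<bar>\<phi> (?z t)\<bar> \<le> C" for t by (rule C)
      show "\<bar>?D (?z t)\<bar> \<le> C'" for t by (rule C')
    qed
    finally show "(\<integral>t. ?Y t z \<partial>lborel) = f z * \<phi> z" by simp
  qed
  finally show ?thesis .
qed

text \<open>A rearrangement of \<open>Rf_weak\<close>; boundedness of the test function and its
  transport derivative makes the three products separately integrable.\<close>

lemma T0rel_Rf:
  assumes f: "L1 f" and nn: "\<And>z. 0 \<le> f z"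
  shows "T0rel (Rf f) (\<lambda>z. rate (snd z) * Rf f z - f z)"
  unfolding T0rel_def
proof (intro conjI allI impI)
  note L = Rf_integrability[OF f nn]
  show "L1 (Rf f)" by (rule L(2))
  show "L1 (\<lambda>z. rate (snd z) * Rf f z - f z)" using L f by (intro L1_diff)
  fix \<phi> :: fn assume \<phi>: "test_fun \<phi>"
  let ?D = "\<lambda>z. frechet_derivative \<phi> (at z) (snd z, 0)"
  note props = test_fun_props[OF \<phi>]
  have [measurable]: "\<phi> \<in> borel_measurable borel" "?D \<in> borel_measurable borel"
    using props by (auto intro: borel_measurable_continuous_onI)
  have i1: "L1 (\<lambda>z. rate (snd z) * Rf f z * \<phi> z)"
    by (rule L1_mult_bounded[OF L(1) _ props(3)]) measurable
  have i2: "L1 (\<lambda>z. f z * \<phi> z)" by (rule L1_mult_bounded[OF f _ props(3)]) measurable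
  have i3: "L1 (\<lambda>z. Rf f z * ?D z)" by (rule L1_mult_bounded[OF L(2) _ props(4)]) measurable
  have "(\<integral>z. f z * \<phi> z \<partial>lborel) = (\<integral>z. rate (snd z) * Rf f z * \<phi> z - Rf f z * ?D z \<partial>lborel)"
    unfolding Rf_weak[OF f nn \<phi>, symmetric] by (simp add: algebra_simps)
  also have "\<dots> = (\<integral>z. rate (snd z) * Rf f z * \<phi> z \<partial>lborel) - (\<integral>z. Rf f z * ?D z \<partial>lborel)"
    using i1 i3 unfolding L1_def by (rule Bochner_Integration.integral_diff)
  finally have eq: "(\<integral>z. f z * \<phi> z \<partial>lborel) = \<dots>" .
  have "(\<integral>z. (rate (snd z) * Rf f z - f z) * \<phi> z \<partial>lborel) = (\<integral>z. rate (snd z) * Rf f z * \<phi> z - f z * \<phi> z \<partial>lborel)"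
    by (simp only: left_diff_distrib)
  also have "\<dots> = (\<integral>z. rate (snd z) * Rf f z * \<phi> z \<partial>lborel) - (\<integral>z. f z * \<phi> z \<partial>lborel)"
    using i1 i2 unfolding L1_def by (rule Bochner_Integration.integral_diff)
  finally show "(\<integral>z. (rate (snd z) * Rf f z - f z) * \<phi> z \<partial>lborel) = (\<integral>z. Rf f z * ?D z \<partial>lborel)"
    using eq by simp
qed

end

section \<open>The Neumann iteration\<close>

lemma T0rel_linear:
  assumes 1: "T0rel f g" and 2: "T0rel f' g'"
  shows "T0rel (\<lambda>z. f z + c * f' z) (\<lambda>z. g z + c * g' z)"
  unfolding T0rel_def
proof (intro conjI allI impI)
  have L: "L1 f" "L1 g" "L1 f'" "L1 g'" using 1 2 unfolding T0rel_def by auto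
  show "L1 (\<lambda>z. f z + c * f' z)" "L1 (\<lambda>z. g z + c * g' z)" using L by (intro L1_add L1_scale; simp)+
  fix \<phi> :: fn assume \<phi>: "test_fun \<phi>"
  let ?D = "\<lambda>z. frechet_derivative \<phi> (at z) (snd z, 0)"
  note props = test_fun_props[OF \<phi>]
  have meas: "\<phi> \<in> borel_measurable borel" "?D \<in> borel_measurable borel"
    using props by (auto intro: borel_measurable_continuous_onI)
  have lin: "(\<integral>z. (u z + c * u' z) * h z \<partial>lborel) = (\<integral>z. u z * h z \<partial>lborel) + c * (\<integral>z. u' z * h z \<partial>lborel)"
    if "L1 u" "L1 u'" "h \<in> borel_measurable borel" "\<exists>C. \<forall>z. \<bar>h z\<bar> \<le> C" for u u' h :: fn
  proof -
    have "(\<integral>z. (u z + c * u' z) * h z \<partial>lborel) = (\<integral>z. u z * h z + c * (u' z * h z) \<partial>lborel)"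
      by (simp add: algebra_simps)
    then show ?thesis
      using L1_mult_bounded[OF that(1,3,4)] L1_mult_bounded[OF that(2,3,4)] by (simp add: L1_def)
  qed
  have "(\<integral>z. g z * \<phi> z \<partial>lborel) = (\<integral>z. f z * ?D z \<partial>lborel)"
       "(\<integral>z. g' z * \<phi> z \<partial>lborel) = (\<integral>z. f' z * ?D z \<partial>lborel)"
    using 1 2 \<phi> unfolding T0rel_def by auto
  then show "(\<integral>z. (g z + c * g' z) * \<phi> z \<partial>lborel) = (\<integral>z. (f z + c * f' z) * ?D z \<partial>lborel)"
    using lin[OF L(2,4) meas(1) props(3)] lin[OF L(1,3) meas(2) props(4)] by simp
qed

context collision
begin

section \<open>The real collision operator on nonnegative functions\<close>

abbreviation KK :: "fn \<Rightarrow> fn" where "KK \<equiv> Kop m m1 eps u1 th1"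

abbreviation kint :: "fn \<Rightarrow> phase \<Rightarrow> vec3 \<times> vec3 \<Rightarrow> real" where
  "kint f z p \<equiv> B (snd z) p * f (fst z, vst (snd z) p) * M (wst (snd z) p)"

lemma KK_eq: "KK f z = eps powr (-2) * (\<integral>p. kint f z p \<partial>mu)"
  by (simp add: Kop_def Let_def)

lemma kint_measurable:
  assumes "f \<in> borel_measurable borel"
  shows "kint f z \<in> borel_measurable mu"
proof -
  have [measurable]: "f \<in> borel_measurable (borel \<Otimes>\<^sub>M borel)" using assms by (simp add: borel_prod)
  show ?thesis unfolding vstar_def wstar_def by measurable
qed

lemma Kpos_kint:
  assumes "\<And>z. 0 \<le> f z"
  shows "Kpos (\<lambda>z. ennreal (f z)) z = ennreal (eps powr (-2)) * (\<integral>\<^sup>+p. ennreal (kint f z p) \<partial>mu)"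
  unfolding Kpos_def using assms
  by (intro arg_cong2[where f = "(*)"] refl nn_integral_cong)
    (simp add: ennreal_mult[symmetric] Maxw_nonneg mult_ac)

text \<open>Holds also where the collision integral diverges, both conventions giving 0
  there.\<close>

lemma Kop_eq_Kpos:
  assumes f: "f \<in> borel_measurable borel" and nn: "\<And>z. 0 \<le> f z"
  shows "KK f z = enn2real (Kpos (\<lambda>z. ennreal (f z)) z)"
proof -
  have "(\<integral>p. kint f z p \<partial>mu) = enn2real (\<integral>\<^sup>+p. ennreal (kint f z p) \<partial>mu)"
    using nn kint_measurable[OF f] by (intro integral_eq_nn_integral) (auto simp: Maxw_nonneg)
  then show ?thesis unfolding KK_eq Kpos_kint[of f, OF nn] by (simp add: enn2real_mult)
qed

lemma Kop_nonneg:
  assumes "\<And>z. 0 \<le> f z"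
  shows "0 \<le> KK f z"
  unfolding KK_eq using assms by (intro mult_nonneg_nonneg integral_nonneg_AE) (auto simp: Maxw_nonneg)

lemma Kop_measurable:
  assumes f: "f \<in> borel_measurable borel" and nn: "\<And>z. 0 \<le> f z"
  shows "KK f \<in> borel_measurable borel"
proof -
  have "(\<lambda>z. ennreal (f z)) \<in> borel_measurable (borel \<Otimes>\<^sub>M borel)" using f by (simp add: borel_prod)
  then have "Kpos (\<lambda>z. ennreal (f z)) \<in> borel_measurable borel"
    using Kpos_measurable by (simp add: borel_prod)
  then have "(\<lambda>z. enn2real (Kpos (\<lambda>z. ennreal (f z)) z)) \<in> borel_measurable borel" by measurable
  then show ?thesis using Kop_eq_Kpos[OF f nn] by (simp cong: measurable_cong)
qed

text \<open>Duality with the weight 1 gives \<open>Kpos\<close> the integral of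
  \<open>sig * f\<close>, which is finite.\<close>

lemma AE_Kpos_finite:
  assumes f: "f \<in> borel_measurable borel" and nn: "\<And>z. 0 \<le> f z" and L: "L1 (\<lambda>z. sig (snd z) * f z)"
  shows "AE z in lborel. Kpos (\<lambda>z. ennreal (f z)) z < \<infinity>"
proof -
  note [measurable] = f
  have [measurable]: "Kpos (\<lambda>z. ennreal (f z)) \<in> borel_measurable borel"
    using Kpos_measurable[of "\<lambda>z. ennreal (f z)"] f by (simp add: borel_prod)
  have "(\<integral>\<^sup>+z. Kpos (\<lambda>z. ennreal (f z)) z \<partial>lborel) = (\<integral>\<^sup>+z. ennreal (f z) * ennreal (sig (snd z)) \<partial>lborel)"
    using Kpos_duality[of "\<lambda>z. ennreal (f z)" "\<lambda>_. 1"] by (simp add: Kadj_one)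
  also have "\<dots> = (\<integral>\<^sup>+z. ennreal (sig (snd z) * f z) \<partial>lborel)"
    using nn sig_nonneg by (simp add: ennreal_mult mult.commute)
  also have "\<dots> < \<infinity>"
    using L nn sig_nonneg by (simp add: L1_def nn_integral_eq_integral)
  finally have "AE z in lborel. Kpos (\<lambda>z. ennreal (f z)) z \<noteq> \<infinity>"
    by (intro nn_integral_PInf_AE) auto
  then show ?thesis by (simp add: less_top)
qed

lemma AE_kint_integrable:
  assumes f: "f \<in> borel_measurable borel" and nn: "\<And>z. 0 \<le> f z" and L: "L1 (\<lambda>z. sig (snd z) * f z)"
  shows "AE z in lborel. integrable mu (kint f z)"
  using AE_Kpos_finite[OF assms]
proof eventually_elim
  case (elim z)
  have "ennreal (eps powr (-2)) \<noteq> 0" using eps0 by simp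
  with elim have "(\<integral>\<^sup>+p. ennreal (kint f z p) \<partial>mu) < \<infinity>"
    unfolding Kpos_kint[of f, OF nn] by (auto simp: ennreal_mult_less_top)
  then show ?case
    using nn kint_measurable[OF f] by (intro integrableI_nonneg) (auto simp: Maxw_nonneg)
qed

lemma Kop_duality:
  assumes f: "f \<in> borel_measurable borel" and nn: "\<And>z. 0 \<le> f z" and L: "L1 (\<lambda>z. sig (snd z) * f z)"
    and g[measurable]: "g \<in> borel_measurable borel" and gn: "\<And>v. 0 \<le> g v"
  shows "(\<integral>\<^sup>+z. ennreal (g (snd z) * KK f z) \<partial>lborel) = (\<integral>\<^sup>+z. ennreal (f z) * Kadj (\<lambda>v. ennreal (g v)) (snd z) \<partial>lborel)"
proof -
  have "(\<integral>\<^sup>+z. ennreal (g (snd z) * KK f z) \<partial>lborel) = (\<integral>\<^sup>+z. Kpos (\<lambda>z. ennreal (f z)) z * ennreal (g (snd z)) \<partial>lborel)"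
  proof (rule nn_integral_cong_AE)
    show "AE z in lborel. ennreal (g (snd z) * KK f z) = Kpos (\<lambda>z. ennreal (f z)) z * ennreal (g (snd z))"
      using AE_Kpos_finite[OF f nn L]
    proof eventually_elim
      case (elim z)
      then have "ennreal (KK f z) = Kpos (\<lambda>z. ennreal (f z)) z"
        by (simp add: Kop_eq_Kpos[OF f nn])
      then show ?case using gn Kop_nonneg[of f z] nn by (simp add: ennreal_mult mult.commute)
    qed
  qed
  also have "\<dots> = (\<integral>\<^sup>+z. ennreal (f z) * Kadj (\<lambda>v. ennreal (g v)) (snd z) \<partial>lborel)"
    using f by (intro Kpos_duality) auto
  finally show ?thesis .
qed

lemma L1_Kop:
  assumes f: "f \<in> borel_measurable borel" and nn: "\<And>z. 0 \<le> f z" and L: "L1 (\<lambda>z. sig (snd z) * f z)"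
  shows "L1 (KK f)" and "(\<integral>z. KK f z \<partial>lborel) = (\<integral>z. sig (snd z) * f z \<partial>lborel)"
proof -
  have eq: "(\<integral>\<^sup>+z. ennreal (KK f z) \<partial>lborel) = (\<integral>\<^sup>+z. ennreal (sig (snd z) * f z) \<partial>lborel)"
    using Kop_duality[OF f nn L, of "\<lambda>_. 1"] nn sig_nonneg by (simp add: Kadj_one ennreal_mult mult.commute)
  have fin: "(\<integral>\<^sup>+z. ennreal (sig (snd z) * f z) \<partial>lborel) < \<infinity>"
    using L nn sig_nonneg by (simp add: L1_def nn_integral_eq_integral)
  note m = Kop_measurable[OF f nn]
  note n = Kop_nonneg[of f, OF nn]
  show "L1 (KK f)" unfolding L1_def using m n eq fin by (intro integrableI_nonneg) auto
  show "(\<integral>z. KK f z \<partial>lborel) = (\<integral>z. sig (snd z) * f z \<partial>lborel)"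
    using m n eq L nn sig_nonneg by (simp add: integral_eq_nn_integral L1_def borel_measurable_integrable)
qed

text \<open>Integrability of the collision integrand is recorded because \<^term>\<open>Kop\<close> takes the junk
  value \<open>0\<close> where it fails, which would break linearity.\<close>

definition cons_dom :: "fn \<Rightarrow> fn \<Rightarrow> bool" where
  "cons_dom f g \<longleftrightarrow> AKrel m m1 eps u1 th1 f g \<and> (\<integral>z. g z \<partial>lborel) = 0
     \<and> (AE z in lborel. integrable mu (kint f z))"

lemma cons_dom_linear:
  assumes 1: "cons_dom f g" and 2: "cons_dom f' g'"
  shows "cons_dom (\<lambda>z. f z + c * f' z) (\<lambda>z. g z + c * g' z)"
proof -
  obtain h k where h: "L1 g" "L1 h" "aeq g (\<lambda>z. h z + KK f z)" "T0rel f k" "L1 (\<lambda>z. sig (snd z) * f z)"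
      "aeq h (\<lambda>z. k z - sig (snd z) * f z)"
    using 1 unfolding cons_dom_def AKrel_def Arel_def by blast
  obtain h' k' where h': "L1 g'" "L1 h'" "aeq g' (\<lambda>z. h' z + KK f' z)" "T0rel f' k'" "L1 (\<lambda>z. sig (snd z) * f' z)"
      "aeq h' (\<lambda>z. k' z - sig (snd z) * f' z)"
    using 2 unfolding cons_dom_def AKrel_def Arel_def by blast
  have int: "AE z in lborel. integrable mu (kint f z)" "AE z in lborel. integrable mu (kint f' z)"
    using 1 2 by (auto simp: cons_dom_def)
  have kint: "kint (\<lambda>z. f z + c * f' z) z = (\<lambda>p. kint f z p + c * kint f' z p)" for z
    by (simp add: algebra_simps)
  have T: "T0rel (\<lambda>z. f z + c * f' z) (\<lambda>z. k z + c * k' z)" using h h' by (intro T0rel_linear)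
  have S: "L1 (\<lambda>z. sig (snd z) * (f z + c * f' z))"
    using L1_add[OF h(5) L1_scale[OF h'(5), of c]] by (simp add: algebra_simps)
  have A: "Arel m1 u1 th1 (\<lambda>z. f z + c * f' z) (\<lambda>z. h z + c * h' z)"
    unfolding Arel_def
  proof (intro conjI exI)
    show "L1 (\<lambda>z. h z + c * h' z)" using h h' by (intro L1_add L1_scale)
    show "aeq (\<lambda>z. h z + c * h' z) (\<lambda>z. k z + c * k' z - sig (snd z) * (f z + c * f' z))"
      using h(6) h'(6) unfolding aeq_def
    proof eventually_elim
      case (elim z)
      show ?case unfolding elim by (simp add: algebra_simps)
    qed
  qed (rule T, rule S)
  have "aeq (\<lambda>z. g z + c * g' z) (\<lambda>z. h z + c * h' z + KK (\<lambda>z. f z + c * f' z) z)"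
    using h(3) h'(3) int unfolding aeq_def
  proof eventually_elim
    case (elim z)
    have "KK (\<lambda>z. f z + c * f' z) z = KK f z + c * KK f' z"
      unfolding KK_eq kint using elim(3,4) by (simp add: algebra_simps)
    with elim(1,2) show ?case by (simp add: algebra_simps)
  qed
  then have "AKrel m m1 eps u1 th1 (\<lambda>z. f z + c * f' z) (\<lambda>z. g z + c * g' z)"
    unfolding AKrel_def using A h h' by (intro conjI exI L1_add L1_scale)
  moreover have "(\<integral>z. g z + c * g' z \<partial>lborel) = 0"
    using 1 2 h h' by (simp add: cons_dom_def L1_def)
  moreover have "AE z in lborel. integrable mu (kint (\<lambda>z. f z + c * f' z) z)"
    using int unfolding kint by eventually_elim simp
  ultimately show ?thesis by (simp add: cons_dom_def)
qed

text \<open>\<open>A\<close> sends \<open>Rf f\<close> to \<open>lam * Rf f - f\<close>. The total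
  mass vanishes because \<open>rate * Rf f\<close> has the integral of \<open>f\<close>, while
  \<open>KK (Rf f)\<close> has that of \<open>sig * Rf f\<close>.\<close>

lemma cons_dom_Rf:
  assumes f: "L1 f" and nn: "\<And>z. 0 \<le> f z"
  shows "cons_dom (Rf f) (\<lambda>z. lam * Rf f z - f z + KK (Rf f) z)"
proof -
  note L = Rf_integrability[OF f nn]
  have m: "Rf f \<in> borel_measurable borel" using f by (simp add: L1_def Rf_measurable)
  note K = L1_Kop[OF m Rf_nonneg L(3)]
  have L0: "L1 (\<lambda>z. lam * Rf f z - f z)" using L f by (intro L1_intros)
  have "Arel m1 u1 th1 (Rf f) (\<lambda>z. lam * Rf f z - f z)"
    unfolding Arel_def
  proof (intro conjI exI)
    show "T0rel (Rf f) (\<lambda>z. rate (snd z) * Rf f z - f z)" using f nn by (rule T0rel_Rf)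
  qed (use L0 L in \<open>auto simp: aeq_def algebra_simps\<close>)
  then have "AKrel m m1 eps u1 th1 (Rf f) (\<lambda>z. lam * Rf f z - f z + KK (Rf f) z)"
    unfolding AKrel_def using L0 K by (intro conjI exI L1_add) (auto simp: aeq_def)
  moreover have "(\<integral>z. lam * Rf f z - f z + KK (Rf f) z \<partial>lborel) = 0"
  proof -
    have "(\<integral>z. lam * Rf f z - f z + KK (Rf f) z \<partial>lborel)
       = (\<integral>z. rate (snd z) * Rf f z - sig (snd z) * Rf f z - f z + KK (Rf f) z \<partial>lborel)"
      by (simp add: algebra_simps)
    also have "\<dots> = (\<integral>z. rate (snd z) * Rf f z \<partial>lborel) - (\<integral>z. sig (snd z) * Rf f z \<partial>lborel)
        - (\<integral>z. f z \<partial>lborel) + (\<integral>z. KK (Rf f) z \<partial>lborel)"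
      using L(1,3) f K(1) unfolding L1_def by simp
    finally show ?thesis using L(4) K(2) by simp
  qed
  moreover have "AE z in lborel. integrable mu (kint (Rf f) z)"
    using m Rf_nonneg L(3) by (rule AE_kint_integrable)
  ultimately show ?thesis by (simp add: cons_dom_def)
qed

section \<open>Decay of the iterates in the energy norm\<close>

definition wt :: "fn \<Rightarrow> ennreal" where
  "wt f = (\<integral>\<^sup>+z. ennreal (psi (snd z) * f z) \<partial>lborel)"

text \<open>Nonnegativity is required at every point, matching the hypotheses of the lemmas on
  \<open>Rf\<close> and \<open>KK\<close>, and the iteration preserves it in this form.\<close>

definition adm :: "fn \<Rightarrow> bool" where
  "adm f \<longleftrightarrow> f \<in> borel_measurable borel \<and> (\<forall>z. 0 \<le> f z) \<and> wt f < \<infinity>"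

lemma nn_integral_le_wt:
  assumes "\<And>z. 0 \<le> f z"
  shows "(\<integral>\<^sup>+z. ennreal (f z) \<partial>lborel) \<le> wt f"
  unfolding wt_def
proof (intro nn_integral_mono ennreal_leI)
  fix z show "f z \<le> psi (snd z) * f z"
    using mult_right_mono[OF psi_ge_1[of "snd z"] assms[of z]] by simp
qed

lemma adm_L1: "adm f \<Longrightarrow> L1 f"
  unfolding L1_def adm_def using nn_integral_le_wt[of f]
  by (intro integrableI_nonneg) (auto intro: le_less_trans)

lemma iteration_step:
  assumes "adm h"
  shows "adm (KK (Rf h))" and "wt (KK (Rf h)) + wt (Rf h) \<le> wt h"
    and "(\<integral>\<^sup>+z. ennreal (KK (Rf h) z) \<partial>lborel) \<le> ennreal (2 * mom) * wt (Rf h)"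
proof -
  have h[measurable]: "h \<in> borel_measurable borel" and nn: "\<And>z. 0 \<le> h z" and wt: "wt h < \<infinity>"
    using assms by (auto simp: adm_def)
  note L = Rf_integrability[OF adm_L1[OF assms] nn]
  have m[measurable]: "Rf h \<in> borel_measurable borel" by measurable
  have fin: "(\<integral>\<^sup>+z. ennreal (h z) \<partial>lborel) < \<infinity>"
    using nn_integral_le_wt[of h] nn wt by (auto intro: le_less_trans)
  have psi0: "0 \<le> psi v" for v using psi_ge_1[of v] by linarith
  have "wt (KK (Rf h)) = (\<integral>\<^sup>+z. ennreal (Rf h z) * Kadj (\<lambda>v. ennreal (psi v)) (snd z) \<partial>lborel)"
    unfolding wt_def using m Rf_nonneg L(3) psi0 by (intro Kop_duality) auto
  also have "\<dots> \<le> (\<integral>\<^sup>+z. ennreal (Rf h z) * ennreal ((sig (snd z) + lam - 1) * psi (snd z)) \<partial>lborel)"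
    by (intro nn_integral_mono mult_left_mono Kadj_psi) auto
  finally have "wt (KK (Rf h)) + wt (Rf h)
     \<le> (\<integral>\<^sup>+z. ennreal (Rf h z) * ennreal ((sig (snd z) + lam - 1) * psi (snd z)) \<partial>lborel)
       + (\<integral>\<^sup>+z. ennreal (psi (snd z) * Rf h z) \<partial>lborel)"
    unfolding wt_def[of "Rf h"] by (rule add_right_mono)
  also have "\<dots> = (\<integral>\<^sup>+z. ennreal (Rf h z) * ennreal ((sig (snd z) + lam - 1) * psi (snd z)) + ennreal (psi (snd z) * Rf h z) \<partial>lborel)"
    by (rule nn_integral_add[symmetric]) measurable
  \<comment> \<open>The spare copy of \<open>psi\<close> completes \<open>sig + lam - 1\<close> to
    \<open>rate\<close>, and the energy balance of the resolvent then returns exactly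
    \<open>wt h\<close>.\<close>
  also have "\<dots> = (\<integral>\<^sup>+z. ennreal (psi (snd z) * rate (snd z) * Rf h z) \<partial>lborel)"
  proof (rule nn_integral_cong)
    fix z :: phase
    have "0 \<le> (sig (snd z) + lam - 1) * psi (snd z)" using sig_nonneg[of "snd z"] lam_ge_1 psi0 by simp
    then have "ennreal (Rf h z) * ennreal ((sig (snd z) + lam - 1) * psi (snd z)) + ennreal (psi (snd z) * Rf h z)
       = ennreal (Rf h z * ((sig (snd z) + lam - 1) * psi (snd z)) + psi (snd z) * Rf h z)"
      using Rf_nonneg[of h z] psi0[of "snd z"]
      by (simp add: ennreal_mult[symmetric] ennreal_plus[symmetric] del: ennreal_plus)
    also have "Rf h z * ((sig (snd z) + lam - 1) * psi (snd z)) + psi (snd z) * Rf h z = psi (snd z) * rate (snd z) * Rf h z"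
      by (simp add: algebra_simps)
    finally show "ennreal (Rf h z) * ennreal ((sig (snd z) + lam - 1) * psi (snd z)) + ennreal (psi (snd z) * Rf h z)
       = ennreal (psi (snd z) * rate (snd z) * Rf h z)" .
  qed
  also have "\<dots> = wt h"
    unfolding wt_def using nn psi0 fin by (intro Rf_moment) auto
  finally show le: "wt (KK (Rf h)) + wt (Rf h) \<le> wt h" .
  have "wt (KK (Rf h)) \<le> wt (KK (Rf h)) + wt (Rf h)" by simp
  also note le
  finally have "wt (KK (Rf h)) < \<infinity>" using wt by (rule le_less_trans)
  then show "adm (KK (Rf h))"
    unfolding adm_def using Kop_measurable[OF m Rf_nonneg] Kop_nonneg[of "Rf h"] Rf_nonneg by auto
  have "(\<integral>\<^sup>+z. ennreal (KK (Rf h) z) \<partial>lborel) = (\<integral>\<^sup>+z. ennreal (Rf h z) * ennreal (sig (snd z)) \<partial>lborel)"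
    using Kop_duality[OF m Rf_nonneg L(3), of "\<lambda>_. 1"] by (simp add: Kadj_one)
  also have "\<dots> \<le> (\<integral>\<^sup>+z. ennreal (2 * mom) * ennreal (psi (snd z) * Rf h z) \<partial>lborel)"
  proof (rule nn_integral_mono)
    fix z :: phase
    have "Rf h z * sig (snd z) \<le> Rf h z * (2 * mom * psi (snd z))"
      using sig_le_psi Rf_nonneg by (intro mult_left_mono)
    then have "ennreal (Rf h z * sig (snd z)) \<le> ennreal ((2 * mom) * (psi (snd z) * Rf h z))"
      by (intro ennreal_leI) (simp add: mult_ac)
    then show "ennreal (Rf h z) * ennreal (sig (snd z)) \<le> ennreal (2 * mom) * ennreal (psi (snd z) * Rf h z)"
      using Rf_nonneg[of h z] sig_nonneg[of "snd z"] psi0[of "snd z"] mom_nonneg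
      by (simp add: ennreal_mult[symmetric])
  qed
  also have "\<dots> = ennreal (2 * mom) * wt (Rf h)"
    unfolding wt_def by (rule nn_integral_cmult) measurable
  finally show "(\<integral>\<^sup>+z. ennreal (KK (Rf h) z) \<partial>lborel) \<le> ennreal (2 * mom) * wt (Rf h)" .
qed

primrec iter :: "fn \<Rightarrow> nat \<Rightarrow> fn" where
  "iter h 0 = h"
| "iter h (Suc n) = KK (Rf (iter h n))"

lemma adm_iter: "adm h \<Longrightarrow> adm (iter h n)"
  by (induction n) (auto intro: iteration_step)

lemma iter_tendsto_zero:
  assumes h: "adm h"
  shows "(\<lambda>n. l1norm (iter h n)) \<longlonglongrightarrow> 0"
proof -
  let ?b = "\<lambda>n. wt (Rf (iter h n))"
  \<comment> \<open>Keeping \<open>wt (iter h n)\<close> on the left is what carries the induction;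
    it is dropped afterwards, leaving bounded partial sums.\<close>
  have tel: "wt (iter h n) + (\<Sum>k<n. ?b k) \<le> wt h" for n
  proof (induction n)
    case (Suc n)
    have "wt (iter h (Suc n)) + (\<Sum>k<Suc n. ?b k) = (wt (KK (Rf (iter h n))) + ?b n) + (\<Sum>k<n. ?b k)"
      by (simp add: ac_simps)
    also have "\<dots> \<le> wt (iter h n) + (\<Sum>k<n. ?b k)"
      using iteration_step(2)[OF adm_iter[OF h, of n]] by (rule add_right_mono)
    finally show ?case using Suc by (rule order_trans)
  qed simp
  have wt: "wt h < \<infinity>" using h by (simp add: adm_def)
  have sumb: "(\<Sum>k<n. ?b k) \<le> wt h" for n
    using tel[of n] by (rule order_trans[rotated]) simp
  have bfin: "?b n < \<infinity>" for n
  proof -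
    have "?b n \<le> (\<Sum>k<Suc n. ?b k)" by simp
    also note sumb[of "Suc n"]
    finally show ?thesis using wt by (rule le_less_trans)
  qed
  define b where "b n = enn2real (?b n)" for n
  have b: "?b n = ennreal (b n)" for n using bfin[of n] by (simp add: b_def)
  have b0: "0 \<le> b n" for n by (simp add: b_def)
  have "summable b"
  proof (rule summableI_nonneg_bounded[OF b0])
    fix n
    have "ennreal (\<Sum>k<n. b k) = (\<Sum>k<n. ?b k)" unfolding b using b0 by (simp add: sum_ennreal)
    also have "\<dots> \<le> ennreal (enn2real (wt h))" using sumb[of n] wt by simp
    finally show "(\<Sum>k<n. b k) \<le> enn2real (wt h)" by (simp add: ennreal_le_iff)
  qed
  then have "b \<longlonglongrightarrow> 0" by (rule summable_LIMSEQ_zero)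
  then have "(\<lambda>n. 2 * mom * b n) \<longlonglongrightarrow> 2 * mom * 0" by (intro tendsto_intros)
  then have lim: "(\<lambda>n. 2 * mom * b n) \<longlonglongrightarrow> 0" by simp
  have "l1norm (iter h (Suc n)) \<le> 2 * mom * b n" for n
  proof -
    have a: "adm (iter h (Suc n))" using adm_iter[OF h] .
    then have nn: "0 \<le> iter h (Suc n) z" for z unfolding adm_def by blast
    have "ennreal (l1norm (iter h (Suc n))) = (\<integral>\<^sup>+z. ennreal (iter h (Suc n) z) \<partial>lborel)"
      unfolding l1norm_def abs_of_nonneg[OF nn]
      using adm_L1[OF a] nn unfolding L1_def by (intro nn_integral_eq_integral[symmetric]) auto
    also have "\<dots> \<le> ennreal (2 * mom) * ?b n"
      using iteration_step(3)[OF adm_iter[OF h, of n]] by simp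
    also have "\<dots> = ennreal (2 * mom * b n)" unfolding b using b0 mom_nonneg by (simp add: ennreal_mult)
    finally show ?thesis using b0 mom_nonneg by (simp add: ennreal_le_iff)
  qed
  then have "(\<lambda>n. l1norm (iter h (Suc n))) \<longlonglongrightarrow> 0"
    by (intro l1norm_tendsto_zero_squeeze[OF _ lim]) simp
  then show ?thesis by (rule LIMSEQ_imp_Suc)
qed

text \<open>The witness \<open>f\<close> is the Neumann sum with \<open>n + 1\<close> terms, built
  one term at a time; each new term replaces the remainder \<open>iter h (Suc n)\<close> by the next
  one. The identity holds at every point.\<close>

lemma cons_dom_iter:
  assumes h: "adm h"
  shows "\<exists>f g. cons_dom f g \<and> (\<forall>z. lam * f z - g z = h z - iter h (Suc n) z)"
proof (induction n)
  case 0
  have "cons_dom (Rf h) (\<lambda>z. lam * Rf h z - h z + KK (Rf h) z)"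
    using h adm_L1[OF h] by (intro cons_dom_Rf) (auto simp: adm_def)
  then show ?case by (intro exI conjI) auto
next
  case (Suc n)
  then obtain f g where fg: "cons_dom f g" "\<And>z. lam * f z - g z = h z - iter h (Suc n) z" by blast
  let ?h = "iter h (Suc n)"
  have a: "adm ?h" using h by (rule adm_iter)
  have "cons_dom (Rf ?h) (\<lambda>z. lam * Rf ?h z - ?h z + KK (Rf ?h) z)"
    using a adm_L1[OF a] by (intro cons_dom_Rf) (auto simp: adm_def)
  from cons_dom_linear[OF fg(1) this, of 1]
  show ?case
  proof (intro exI conjI allI)
    fix z
    show "lam * (f z + 1 * Rf ?h z) - (g z + 1 * (lam * Rf ?h z - ?h z + KK (Rf ?h) z)) = h z - iter h (Suc (Suc n)) z"
      using fg(2)[of z] by (simp add: algebra_simps)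
  qed
qed

lemma dense_range_adm:
  assumes h: "adm h" and d: "0 < d"
  shows "\<exists>f g. cons_dom f g \<and> l1norm (\<lambda>z. lam * f z - g z - h z) < d"
proof -
  have "(\<lambda>n. l1norm (iter h (Suc n))) \<longlonglongrightarrow> 0"
    using iter_tendsto_zero[OF h] by (rule LIMSEQ_Suc)
  then have "\<forall>\<^sub>F n in sequentially. l1norm (iter h (Suc n)) < d" using d by (rule order_tendstoD)
  then obtain n where n: "l1norm (iter h (Suc n)) < d" by (auto simp: eventually_sequentially)
  obtain f g where fg: "cons_dom f g" "\<And>z. lam * f z - g z = h z - iter h (Suc n) z"
    using cons_dom_iter[OF h] by blast
  have "l1norm (\<lambda>z. lam * f z - g z - h z) = l1norm (iter h (Suc n))"
    unfolding fg(2) by (simp add: l1norm_def)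
  with n fg(1) show ?thesis by (intro exI conjI) auto
qed

lemma cons_dom_L1: "cons_dom f g \<Longrightarrow> L1 f \<and> L1 g"
  unfolding cons_dom_def AKrel_def Arel_def T0rel_def by blast

text \<open>Cutting off velocities beyond \<open>N\<close> bounds \<open>psi\<close> by
  \<open>1 + N^2\<close>, so the positive and negative parts of the truncation are both admissible.
  Truncation and the two approximations each cost \<open>d / 3\<close>, and linearity of
  \<open>cons_dom\<close> recombines the parts.\<close>

lemma dense_range:
  assumes h: "L1 h" and d: "0 < d"
  shows "\<exists>f g. cons_dom f g \<and> l1norm (\<lambda>z. lam * f z - g z - h z) < d"
proof -
  have hm[measurable]: "h \<in> borel_measurable borel" using h by (simp add: L1_def)
  let ?c = "\<lambda>n z. indicator {v. norm v \<le> real n} (snd z) * h z"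
  have lim: "(\<lambda>n. \<integral>z. \<bar>?c n z - h z\<bar> \<partial>lborel) \<longlonglongrightarrow> (\<integral>z. 0 \<partial>(lborel :: phase measure))"
  proof (rule integral_dominated_convergence)
    show "integrable lborel (\<lambda>z. \<bar>h z\<bar>)" using h by (simp add: L1_def)
    show "AE z in lborel. (\<lambda>n. \<bar>?c n z - h z\<bar>) \<longlonglongrightarrow> 0"
    proof (intro AE_I2)
      fix z :: phase
      obtain N where "norm (snd z) \<le> real N" using real_arch_simple by blast
      then have "\<forall>\<^sub>F n in sequentially. \<bar>?c n z - h z\<bar> = 0"
        unfolding eventually_sequentially by (intro exI[of _ N]) (auto simp: indicator_def)
      then show "(\<lambda>n. \<bar>?c n z - h z\<bar>) \<longlonglongrightarrow> 0" by (rule tendsto_eventually)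
    qed
    show "AE z in lborel. norm \<bar>?c n z - h z\<bar> \<le> \<bar>h z\<bar>" for n
      by (intro AE_I2) (auto simp: indicator_def)
  qed measurable
  then have "\<forall>\<^sub>F n in sequentially. (\<integral>z. \<bar>?c n z - h z\<bar> \<partial>lborel) < d / 3"
    using d by (intro order_tendstoD[of _ 0]) auto
  then obtain N where N: "l1norm (\<lambda>z. ?c N z - h z) < d / 3"
    unfolding l1norm_def by (auto simp: eventually_sequentially)
  have Lc: "L1 (?c N)" unfolding L1_def
    by (rule Bochner_Integration.integrable_bound[OF h[unfolded L1_def]]) (measurable, auto simp: indicator_def)
  let ?p = "\<lambda>z. max 0 (?c N z)" and ?q = "\<lambda>z. max 0 (- ?c N z)"
  have adm: "adm u" if u[measurable]: "u \<in> borel_measurable borel" and u0: "\<And>z. 0 \<le> u z" and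
     u1: "\<And>z. u z \<le> \<bar>h z\<bar>" and u2: "\<And>z. norm (snd z) > real N \<Longrightarrow> u z = 0" for u
  proof -
    have "wt u \<le> (\<integral>\<^sup>+z. ennreal (1 + (real N)\<^sup>2) * ennreal \<bar>h z\<bar> \<partial>lborel)"
      unfolding wt_def
    proof (rule nn_integral_mono)
      fix z :: phase
      have "psi (snd z) * u z \<le> (1 + (real N)\<^sup>2) * \<bar>h z\<bar>"
      proof (cases "norm (snd z) \<le> real N")
        case True
        then have "psi (snd z) \<le> 1 + (real N)\<^sup>2" by (simp add: psi_def power_mono)
        then show ?thesis using u0[of z] u1[of z] by (intro mult_mono) auto
      qed (use u2[of z] in auto)
      then show "ennreal (psi (snd z) * u z) \<le> ennreal (1 + (real N)\<^sup>2) * ennreal \<bar>h z\<bar>"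
        by (subst ennreal_mult[symmetric]) (auto intro: ennreal_leI)
    qed
    also have "\<dots> = ennreal (1 + (real N)\<^sup>2) * (\<integral>\<^sup>+z. ennreal \<bar>h z\<bar> \<partial>lborel)"
      by (rule nn_integral_cmult) measurable
    also have "\<dots> < \<infinity>"
      using h by (simp add: L1_def nn_integral_eq_integral ennreal_mult_less_top)
    finally show ?thesis using u u0 by (simp add: adm_def)
  qed
  have "adm ?p" by (rule adm) (auto simp: indicator_def)
  from dense_range_adm[OF this, of "d / 3"] d
  obtain f g where fg: "cons_dom f g" "l1norm (\<lambda>z. lam * f z - g z - ?p z) < d / 3" by auto
  have "adm ?q" by (rule adm) (auto simp: indicator_def)
  from dense_range_adm[OF this, of "d / 3"] d
  obtain f' g' where fg': "cons_dom f' g'" "l1norm (\<lambda>z. lam * f' z - g' z - ?q z) < d / 3" by auto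
  let ?f = "\<lambda>z. f z + (-1) * f' z" and ?g = "\<lambda>z. g z + (-1) * g' z"
  let ?a = "\<lambda>z. lam * f z - g z - ?p z" and ?b = "\<lambda>z. (-1) * (lam * f' z - g' z - ?q z)"
  have L: "L1 ?p" "L1 ?q" using Lc by (auto simp: L1_def)
  have La: "L1 ?a" "L1 ?b" using cons_dom_L1[OF fg(1)] cons_dom_L1[OF fg'(1)] L
    by (intro L1_diff L1_scale; simp)+
  have "(\<lambda>z. lam * ?f z - ?g z - h z) = (\<lambda>z. (?a z + ?b z) + (?c N z - h z))"
    by (auto simp: fun_eq_iff algebra_simps max_def)
  then have "l1norm (\<lambda>z. lam * ?f z - ?g z - h z) = l1norm (\<lambda>z. (?a z + ?b z) + (?c N z - h z))"
    by (rule arg_cong)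
  also have "\<dots> \<le> l1norm (\<lambda>z. ?a z + ?b z) + l1norm (\<lambda>z. ?c N z - h z)"
    by (rule l1norm_triangle[OF L1_add[OF La] L1_diff[OF Lc h]])
  also have "l1norm (\<lambda>z. ?a z + ?b z) \<le> l1norm ?a + l1norm ?b"
    by (rule l1norm_triangle[OF La])
  also have "l1norm ?b = l1norm (\<lambda>z. lam * f' z - g' z - ?q z)" unfolding l1norm_scale by simp
  finally have "l1norm (\<lambda>z. lam * ?f z - ?g z - h z) < d" using fg(2) fg'(2) N by linarith
  then show ?thesis using cons_dom_linear[OF fg(1) fg'(1), of "-1"] by (intro exI conjI)
qed

end

theorem theorem4p4:
  fixes m m1 eps th1 :: real and u1 :: vec3 and Z :: "real \<Rightarrow> fn \<Rightarrow> fn"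
  assumes "m > 0" and "m1 > 0" and "0 < eps" and "eps < 1" and "th1 > 0"
    and Z_sg: "C0_semigroup Z" and Z_pos: "positive_sg Z" and Z_contr: "contraction_sg Z"
    and Z_ext: "extends_op (generator Z) (AKrel m m1 eps u1 th1)"
    and Z_min: "\<And>T. C0_semigroup T \<Longrightarrow> positive_sg T \<Longrightarrow>
                  extends_op (generator T) (AKrel m m1 eps u1 th1) \<Longrightarrow>
                  \<forall>t\<ge>0. \<forall>f. L1 f \<longrightarrow> (AE z in lborel. 0 \<le> f z) \<longrightarrow>
                     (AE z in lborel. Z t f z \<le> T t f z)"
  shows "(\<forall>f g. generator Z f g \<longleftrightarrow> op_closure (AKrel m m1 eps u1 th1) f g)
       \<and> (\<forall>t\<ge>0. \<forall>f. L1 f \<longrightarrow> (\<integral>z. Z t f z \<partial>lborel) = (\<integral>z. f z \<partial>lborel))"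
proof -
  interpret collision m m1 eps th1 u1 by unfold_locales fact+
  interpret contraction_semigroup Z by unfold_locales fact+
  have "0 < lam" using lam_ge_1 by linarith
  moreover have "\<exists>f g. AKrel m m1 eps u1 th1 f g \<and> (\<integral>z. g z \<partial>lborel) = 0
      \<and> l1norm (\<lambda>z. lam * f z - g z - h z) < d" if "L1 h" "0 < d" for h d
    using dense_range[OF that] unfolding cons_dom_def by blast
  ultimately show ?thesis
    using generator_eq_closure_honest[OF Z_ext] by blast
qed

end
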